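(* Let $(R,\mathfrak m,k)$ be a local ring and let $N$ be an $R$-submodule of a finitely generated $R$-module $M$ such that $\operatorname{Ext}^1_R(k,N)^{\mu}=0$. Then $(\mathfrak mN:_M\mathfrak m)=N+\operatorname{Soc}(M)$, i.e., $N+\operatorname{Soc}(M)$ is a weakly $\mathfrak m$-full submodule of $M$. So, in particular, if we moreover have $\operatorname{depth}(M)>0$, then $N$ is a weakly $\mathfrak m$-full submodule of $M$.
   Context: Local rings are commutative Noetherian. For a submodule $L$ of $M$, $(L:_M\mathfrak m)=\{x\in M:\mathfrak mx\subseteq L\}$, and $\operatorname{Soc}(M)=(0:_M\mathfrak m)$. A submodule $N$ of a finitely generated module $M$ is weakly $\mathfrak m$-full if $(\mathfrak mN:_M\mathfrak m)=N$. $\mu(-)$ is the minimal number of generators. For finitely generated $R$-modules $A,B$, $\operatorname{Ext}^1_R(A,B)^{\mu}$ denotes the subset (in fact an $R$-submodule) of $\operatorname{Ext}^1_R(A,B)$ consisting of the Yoneda classes of short exact sequences $0\to B\to X\to A\to0$ with $\mu(X)=\mu(A)+\mu(B)$. *)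

theory Defs
  imports "HOL-Algebra.Module" "HOL-Algebra.Ring_Divisibility" "HOL-Library.Extended_Nat"
begin

locale noetherian_local_ring = cring R + noetherian_ring R + maximalideal \<mm> R
  for R (structure) and \<mm> +
  assumes maximalideal_unique: "maximalideal J R \<Longrightarrow> J = \<mm>"

text \<open>Meaningful only for \<open>S \<subseteq> carrier M\<close>: otherwise the intersection is empty-indexed, that is \<^const>\<open>UNIV\<close>.\<close>

definition mod_span ::
  "('a, 'm) ring_scheme \<Rightarrow> ('a, 'b, 'n) module_scheme \<Rightarrow> 'b set \<Rightarrow> 'b set"
  where "mod_span R M S = \<Inter>{N. submodule N R M \<and> S \<subseteq> N}"

definition fin_gen_module ::
  "('a, 'm) ring_scheme \<Rightarrow> ('a, 'b, 'n) module_scheme \<Rightarrow> bool"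
  where "fin_gen_module R M \<longleftrightarrow>
    (\<exists>S. finite S \<and> S \<subseteq> carrier M \<and> mod_span R M S = carrier M)"

text \<open>The minimal number of generators. The value is meaningful only for finitely
  generated modules.\<close>

definition min_gens ::
  "('a, 'm) ring_scheme \<Rightarrow> ('a, 'b, 'n) module_scheme \<Rightarrow> nat"
  where "min_gens R M =
    (LEAST n. \<exists>S. finite S \<and> card S = n \<and> S \<subseteq> carrier M \<and> mod_span R M S = carrier M)"

definition ideal_smult ::
  "('a, 'm) ring_scheme \<Rightarrow> ('a, 'b, 'n) module_scheme \<Rightarrow> 'a set \<Rightarrow> 'b set \<Rightarrow> 'b set"
  where "ideal_smult R M I N = mod_span R M {a \<odot>\<^bsub>M\<^esub> x | a x. a \<in> I \<and> x \<in> N}"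

definition mod_colon :: "('a, 'b, 'n) module_scheme \<Rightarrow> 'b set \<Rightarrow> 'a set \<Rightarrow> 'b set"
  where "mod_colon M L I = {x \<in> carrier M. \<forall>a\<in>I. a \<odot>\<^bsub>M\<^esub> x \<in> L}"

definition socle :: "('a, 'b, 'n) module_scheme \<Rightarrow> 'a set \<Rightarrow> 'b set"
  where "socle M \<mm> = mod_colon M {\<zero>\<^bsub>M\<^esub>} \<mm>"

definition weakly_full ::
  "('a, 'm) ring_scheme \<Rightarrow> 'a set \<Rightarrow> ('a, 'b, 'n) module_scheme \<Rightarrow> 'b set \<Rightarrow> bool"
  where "weakly_full R \<mm> M N \<longleftrightarrow>
    submodule N R M \<and> mod_colon M (ideal_smult R M \<mm> N) \<mm> = N"

text \<open>A module record extends a ring record; its fields \<^const>\<open>mult\<close> and \<^const>\<open>one\<close> play no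
  role for modules and are left unspecified.\<close>

definition quot_module :: "('a, 'b, 'n) module_scheme \<Rightarrow> 'b set \<Rightarrow> ('a, 'b set) module"
  where "quot_module M N =
    \<lparr>carrier = a_rcosets\<^bsub>M\<^esub> N, mult = undefined, one = undefined,
     zero = N, add = set_add M,
     smult = (\<lambda>r C. \<Union>x\<in>C. N +>\<^bsub>M\<^esub> (r \<odot>\<^bsub>M\<^esub> x))\<rparr>"

definition regular_module :: "('a, 'm) ring_scheme \<Rightarrow> ('a, 'a) module"
  where "regular_module R =
    \<lparr>carrier = carrier R, mult = undefined, one = undefined,
     zero = \<zero>\<^bsub>R\<^esub>, add = add R, smult = mult R\<rparr>"

definition residue_module :: "('a, 'm) ring_scheme \<Rightarrow> 'a set \<Rightarrow> ('a, 'a set) module"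
  where "residue_module R \<mm> = quot_module (regular_module R) \<mm>"

definition direct_sum ::
  "('a, 'b, 'n) module_scheme \<Rightarrow> ('a, 'c, 'k) module_scheme \<Rightarrow> ('a, 'b \<times> 'c) module"
  where "direct_sum B A =
    \<lparr>carrier = carrier B \<times> carrier A, mult = undefined, one = undefined,
     zero = (\<zero>\<^bsub>B\<^esub>, \<zero>\<^bsub>A\<^esub>),
     add = (\<lambda>(b, a) (b', a'). (b \<oplus>\<^bsub>B\<^esub> b', a \<oplus>\<^bsub>A\<^esub> a')),
     smult = (\<lambda>r (b, a). (r \<odot>\<^bsub>B\<^esub> b, r \<odot>\<^bsub>A\<^esub> a))\<rparr>"

definition nonzerodivisor_on :: "('a, 'b, 'n) module_scheme \<Rightarrow> 'a \<Rightarrow> bool"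
  where "nonzerodivisor_on M r \<longleftrightarrow>
    (\<forall>x\<in>carrier M. r \<odot>\<^bsub>M\<^esub> x = \<zero>\<^bsub>M\<^esub> \<longrightarrow> x = \<zero>\<^bsub>M\<^esub>)"

definition regular_sequence ::
  "('a, 'm) ring_scheme \<Rightarrow> ('a, 'b, 'n) module_scheme \<Rightarrow> 'a list \<Rightarrow> bool"
  where "regular_sequence R M rs \<longleftrightarrow>
    set rs \<subseteq> carrier R \<and>
    (\<forall>i<length rs. nonzerodivisor_on
       (quot_module M (ideal_smult R M (Idl\<^bsub>R\<^esub> (set (take i rs))) (carrier M))) (rs ! i)) \<and>
    ideal_smult R M (Idl\<^bsub>R\<^esub> (set rs)) (carrier M) \<noteq> carrier M"

text \<open>The depth of the zero module is infinite by convention.\<close>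

definition depth ::
  "('a, 'm) ring_scheme \<Rightarrow> 'a set \<Rightarrow> ('a, 'b, 'n) module_scheme \<Rightarrow> enat"
  where "depth R \<mm> M =
    (if carrier M = {\<zero>\<^bsub>M\<^esub>} then \<infinity>
     else Sup {enat (length rs) | rs. set rs \<subseteq> \<mm> \<and> regular_sequence R M rs})"

definition module_homs ::
  "('a, 'm) ring_scheme \<Rightarrow> ('a, 'b, 'n) module_scheme \<Rightarrow> ('a, 'c, 'k) module_scheme \<Rightarrow> ('b \<Rightarrow> 'c) set"
  where "module_homs R M N =
    {h \<in> carrier M \<rightarrow> carrier N.
       (\<forall>x\<in>carrier M. \<forall>y\<in>carrier M. h (x \<oplus>\<^bsub>M\<^esub> y) = h x \<oplus>\<^bsub>N\<^esub> h y) \<and>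
       (\<forall>r\<in>carrier R. \<forall>x\<in>carrier M. h (r \<odot>\<^bsub>M\<^esub> x) = r \<odot>\<^bsub>N\<^esub> h x)}"

type_synonym ('a, 'b, 'c, 'e) extension = "('a, 'e) module \<times> ('b \<Rightarrow> 'e) \<times> ('e \<Rightarrow> 'c)"

text \<open>The triples \<open>(X, i, p)\<close> such that \<open>0 \<rightarrow> B \<rightarrow> X \<rightarrow> A \<rightarrow> 0\<close>, with maps \<open>i\<close> and \<open>p\<close>, is a short
  exact sequence.\<close>

definition short_exact_sequences ::
  "('a, 'm) ring_scheme \<Rightarrow> ('a, 'c, 'k) module_scheme \<Rightarrow> ('a, 'b, 'n) module_scheme
    \<Rightarrow> ('a, 'b, 'c, 'e) extension set"
  where "short_exact_sequences R A B =
    {(X, i, p). module R X \<and> i \<in> module_homs R B X \<and> p \<in> module_homs R X A \<and>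
       inj_on i (carrier B) \<and> i ` carrier B = a_kernel X A p \<and> p ` carrier X = carrier A}"

text \<open>Equality of Yoneda classes: an isomorphism of the middle terms that is compatible with
  the identities of \<open>B\<close> and \<open>A\<close>.\<close>

definition ext_equivalent ::
  "('a, 'm) ring_scheme \<Rightarrow> ('a, 'c, 'k) module_scheme \<Rightarrow> ('a, 'b, 'n) module_scheme
    \<Rightarrow> ('a, 'b, 'c, 'e) extension \<Rightarrow> ('a, 'b, 'c, 'f) extension \<Rightarrow> bool"
  where "ext_equivalent R A B = (\<lambda>(X, i, p) (X', i', p').
    \<exists>\<phi>\<in>module_homs R X X'. bij_betw \<phi> (carrier X) (carrier X') \<and>
      (\<forall>b\<in>carrier B. \<phi> (i b) = i' b) \<and> (\<forall>x\<in>carrier X. p' (\<phi> x) = p x))"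

text \<open>Yoneda classes are formed from extensions whose middle term has elements of type
  \<^typ>\<open>'b \<times> 'c\<close>. This is no restriction: by the lemma \<open>extension_representative\<close> below, an
  extension whose middle term lives on any type is equivalent to one of these.\<close>

definition ext_rel ::
  "('a, 'm) ring_scheme \<Rightarrow> ('a, 'c, 'k) module_scheme \<Rightarrow> ('a, 'b, 'n) module_scheme
    \<Rightarrow> ('a, 'b, 'c, 'b \<times> 'c) extension rel"
  where "ext_rel R A B =
    {(E, E') \<in> short_exact_sequences R A B \<times> short_exact_sequences R A B.
       ext_equivalent R A B E E'}"

definition Ext1 ::
  "('a, 'm) ring_scheme \<Rightarrow> ('a, 'c, 'k) module_scheme \<Rightarrow> ('a, 'b, 'n) module_scheme
    \<Rightarrow> ('a, 'b, 'c, 'b \<times> 'c) extension set set"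
  where "Ext1 R A B = short_exact_sequences R A B // ext_rel R A B"

definition split_extension ::
  "('a, 'c, 'k) module_scheme \<Rightarrow> ('a, 'b, 'n) module_scheme \<Rightarrow> ('a, 'b, 'c, 'b \<times> 'c) extension"
  where "split_extension A B = (direct_sum B A, (\<lambda>b. (b, \<zero>\<^bsub>A\<^esub>)), snd)"

text \<open>The zero element of the group \<^const>\<open>Ext1\<close> is the class of the split extension.\<close>

definition Ext1_zero ::
  "('a, 'm) ring_scheme \<Rightarrow> ('a, 'c, 'k) module_scheme \<Rightarrow> ('a, 'b, 'n) module_scheme
    \<Rightarrow> ('a, 'b, 'c, 'b \<times> 'c) extension set"
  where "Ext1_zero R A B = ext_rel R A B `` {split_extension A B}"

definition Ext1_mu ::
  "('a, 'm) ring_scheme \<Rightarrow> ('a, 'c, 'k) module_scheme \<Rightarrow> ('a, 'b, 'n) module_scheme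
    \<Rightarrow> ('a, 'b, 'c, 'b \<times> 'c) extension set set"
  where "Ext1_mu R A B =
    {\<xi> \<in> Ext1 R A B. \<exists>(X, i, p)\<in>\<xi>. min_gens R X = min_gens R A + min_gens R B}"

lemma (in module) mod_span_submodule:
  assumes "S \<subseteq> carrier M"
  shows "submodule (mod_span R M S) R M"
proof (rule submoduleI)
  note car = carrier_is_submodule
  show "mod_span R M S \<subseteq> carrier M"
    using car assms by (auto simp: mod_span_def)
  show "\<zero>\<^bsub>M\<^esub> \<in> mod_span R M S"
    by (auto simp: mod_span_def submodule_def dest: subgroup.one_closed)
  show "\<ominus>\<^bsub>M\<^esub> a \<in> mod_span R M S" if "a \<in> mod_span R M S" for a
    using that submoduleE(3) by (auto simp: mod_span_def)
  show "a \<oplus>\<^bsub>M\<^esub> b \<in> mod_span R M S" if "a \<in> mod_span R M S" "b \<in> mod_span R M S" for a b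
    using that submoduleE(5) by (auto simp: mod_span_def)
  show "a \<odot>\<^bsub>M\<^esub> x \<in> mod_span R M S" if "a \<in> carrier R" "x \<in> mod_span R M S" for a x
    using that submoduleE(4) by (auto simp: mod_span_def)
qed

lemma quot_module_smult:
  assumes "module R M" "submodule N R M" "r \<in> carrier R" "y \<in> carrier M"
  shows "r \<odot>\<^bsub>quot_module M N\<^esub> (N +>\<^bsub>M\<^esub> y) = N +>\<^bsub>M\<^esub> (r \<odot>\<^bsub>M\<^esub> y)"
proof -
  interpret M: module R M by fact
  interpret N: submodule N R M by fact
  have "N +>\<^bsub>M\<^esub> (r \<odot>\<^bsub>M\<^esub> (n \<oplus>\<^bsub>M\<^esub> y)) = N +>\<^bsub>M\<^esub> (r \<odot>\<^bsub>M\<^esub> y)" if "n \<in> N" for n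
  proof -
    have n: "n \<in> carrier M" "r \<odot>\<^bsub>M\<^esub> n \<in> N" "r \<odot>\<^bsub>M\<^esub> n \<in> carrier M"
      using that assms(3) N.subset by auto
    have "N +>\<^bsub>M\<^esub> (r \<odot>\<^bsub>M\<^esub> (n \<oplus>\<^bsub>M\<^esub> y)) = (N +>\<^bsub>M\<^esub> (r \<odot>\<^bsub>M\<^esub> n)) +>\<^bsub>M\<^esub> (r \<odot>\<^bsub>M\<^esub> y)"
      using n assms N.subset by (simp add: M.smult_r_distr M.a_coset_add_assoc)
    also have "N +>\<^bsub>M\<^esub> (r \<odot>\<^bsub>M\<^esub> n) = N"
      using M.add.coset_join2[OF n(3) N.subgroup_axioms n(2)] by (simp add: a_r_coset_def)
    finally show ?thesis .
  qed
  moreover have "N \<noteq> {}" using N.one_closed by auto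
  ultimately show ?thesis
    by (auto simp: quot_module_def a_r_coset_def')
qed

lemma quot_module_module:
  assumes "module R M" "submodule N R M"
  shows "module R (quot_module M N)"
proof -
  interpret M: module R M by fact
  interpret N: submodule N R M by fact
  interpret N: abelian_subgroup N M
    by (rule abelian_subgroupI3)
       (auto intro: additive_subgroup.intro N.subgroup_axioms M.abelian_group_axioms)
  note [simp] = quot_module_smult[OF assms] N.a_rcos_sum
  have sum: "C \<oplus>\<^bsub>quot_module M N\<^esub> D = C <+>\<^bsub>M\<^esub> D" for C D
    by (simp add: quot_module_def)
  have car: "carrier (quot_module M N) = (\<lambda>y. N +>\<^bsub>M\<^esub> y) ` carrier M"
    by (auto simp: quot_module_def A_RCOSETS_defs a_r_coset_defs)
  have zero: "\<zero>\<^bsub>quot_module M N\<^esub> = N +>\<^bsub>M\<^esub> \<zero>\<^bsub>M\<^esub>"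
    using N.a_subset by (simp add: quot_module_def)
  show ?thesis
  proof (rule moduleI)
    show "cring R" by (rule M.R.cring_axioms)
    show "abelian_group (quot_module M N)"
    proof (rule abelian_groupI)
      fix x assume "x \<in> carrier (quot_module M N)"
      then obtain y where "x = N +>\<^bsub>M\<^esub> y" "y \<in> carrier M" by (auto simp: car)
      then show "\<exists>y\<in>carrier (quot_module M N). y \<oplus>\<^bsub>quot_module M N\<^esub> x = \<zero>\<^bsub>quot_module M N\<^esub>"
        by (intro bexI[of _ "N +>\<^bsub>M\<^esub> (\<ominus>\<^bsub>M\<^esub> y)"]) (auto simp: car sum zero M.l_neg)
    qed (auto simp: car sum zero M.a_ac)
  qed (auto simp: car sum M.smult_l_distr M.smult_r_distr M.smult_assoc1)
qed

lemma residue_module_module: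
  assumes "cring R" "ideal \<mm> R"
  shows "module R (residue_module R \<mm>)"
proof -
  interpret R: cring R by fact
  interpret \<mm>: ideal \<mm> R by fact
  have mod: "module R (regular_module R)"
  proof (rule moduleI)
    show "abelian_group (regular_module R)"
    proof (rule abelian_groupI)
      fix x assume "x \<in> carrier (regular_module R)"
      then show "\<exists>y\<in>carrier (regular_module R). y \<oplus>\<^bsub>regular_module R\<^esub> x = \<zero>\<^bsub>regular_module R\<^esub>"
        by (intro bexI[of _ "\<ominus>\<^bsub>R\<^esub> x"]) (auto simp: regular_module_def R.l_neg)
    qed (auto simp: regular_module_def R.a_ac)
  qed (auto simp: regular_module_def R.l_distr R.r_distr R.m_assoc R.cring_axioms)
  interpret M: module R "regular_module R" by (rule mod)
  have "submodule \<mm> R (regular_module R)"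
  proof (rule M.submoduleI)
    fix a assume a: "a \<in> \<mm>"
    then have "a \<in> carrier R" using \<mm>.a_subset by auto
    have "\<ominus>\<^bsub>regular_module R\<^esub> a = \<ominus>\<^bsub>R\<^esub> a"
      by (simp add: regular_module_def a_inv_def m_inv_def)
    then show "\<ominus>\<^bsub>regular_module R\<^esub> a \<in> \<mm>"
      using a by simp
  qed (use \<mm>.a_subset in \<open>auto simp: regular_module_def intro: \<mm>.I_l_closed\<close>)
  then show ?thesis
    unfolding residue_module_def by (rule quot_module_module[OF mod])
qed

lemma direct_sum_module:
  assumes "module R A" "module R B"
  shows "module R (direct_sum B A)"
proof -
  interpret A: module R A by fact
  interpret B: module R B by fact
  show ?thesis
  proof (rule moduleI)
    show "cring R" by (rule A.R.cring_axioms)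
    show "abelian_group (direct_sum B A)"
    proof (rule abelian_groupI)
      fix x assume "x \<in> carrier (direct_sum B A)"
      then show "\<exists>y\<in>carrier (direct_sum B A). y \<oplus>\<^bsub>direct_sum B A\<^esub> x = \<zero>\<^bsub>direct_sum B A\<^esub>"
        by (intro bexI[of _ "(\<ominus>\<^bsub>B\<^esub> fst x, \<ominus>\<^bsub>A\<^esub> snd x)"])
           (auto simp: direct_sum_def A.l_neg B.l_neg)
    qed (auto simp: direct_sum_def A.a_ac B.a_ac)
  qed (auto simp: direct_sum_def A.smult_l_distr A.smult_r_distr A.smult_assoc1
      B.smult_l_distr B.smult_r_distr B.smult_assoc1)
qed

lemma split_extension_exact:
  assumes "module R A" "module R B"
  shows "split_extension A B \<in> short_exact_sequences R A B"
proof -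
  interpret A: module R A by fact
  interpret B: module R B by fact
  show ?thesis
    using direct_sum_module[OF assms] B.zero_closed
    by (auto simp: split_extension_def short_exact_sequences_def module_homs_def direct_sum_def
        inj_on_def a_kernel_def kernel_def image_iff)
qed

lemma equiv_ext_rel: "equiv (short_exact_sequences R A B) (ext_rel R A B)"
proof (rule equivI)
  show "ext_rel R A B \<subseteq> short_exact_sequences R A B \<times> short_exact_sequences R A B"
    by (auto simp: ext_rel_def)
  show "refl_on (short_exact_sequences R A B) (ext_rel R A B)"
    by (auto simp: refl_on_def ext_rel_def ext_equivalent_def module_homs_def
        intro!: bexI[of _ "\<lambda>x. x"] bij_betw_id[unfolded id_def])
  show "sym (ext_rel R A B)"
  proof (rule symI)
    fix E E' assume rel: "(E, E') \<in> ext_rel R A B"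
    obtain X i p X' i' p' where E: "E = (X, i, p)" "E' = (X', i', p')"
      by (metis prod_cases3)
    have se: "(X, i, p) \<in> short_exact_sequences R A B" "(X', i', p') \<in> short_exact_sequences R A B"
      and "ext_equivalent R A B (X, i, p) (X', i', p')"
      using rel by (auto simp: ext_rel_def E)
    then obtain \<phi> where \<phi>: "\<phi> \<in> module_homs R X X'" "bij_betw \<phi> (carrier X) (carrier X')"
      "\<And>b. b \<in> carrier B \<Longrightarrow> \<phi> (i b) = i' b" "\<And>x. x \<in> carrier X \<Longrightarrow> p' (\<phi> x) = p x"
      by (auto simp: ext_equivalent_def)
    interpret X: module R X using se by (simp add: short_exact_sequences_def)
    interpret X': module R X' using se by (simp add: short_exact_sequences_def)
    have i: "i b \<in> carrier X" if "b \<in> carrier B" for b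
      using se that by (auto simp: short_exact_sequences_def module_homs_def)
    let ?\<psi> = "inv_into (carrier X) \<phi>"
    have b: "bij_betw ?\<psi> (carrier X') (carrier X)"
      using \<phi>(2) by (rule bij_betw_inv_into)
    have c: "?\<psi> y \<in> carrier X" if "y \<in> carrier X'" for y
      using b that by (auto simp: bij_betw_def)
    have l: "?\<psi> (\<phi> x) = x" if "x \<in> carrier X" for x
      using \<phi>(2) that by (simp add: bij_betw_inv_into_left)
    have r: "\<phi> (?\<psi> y) = y" if "y \<in> carrier X'" for y
      using \<phi>(2) that by (simp add: bij_betw_inv_into_right)
    have "?\<psi> (x \<oplus>\<^bsub>X'\<^esub> y) = ?\<psi> x \<oplus>\<^bsub>X\<^esub> ?\<psi> y" if "x \<in> carrier X'" "y \<in> carrier X'" for x y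
    proof -
      have "\<phi> (?\<psi> x \<oplus>\<^bsub>X\<^esub> ?\<psi> y) = x \<oplus>\<^bsub>X'\<^esub> y"
        using \<phi>(1) that by (simp add: module_homs_def c r)
      then show ?thesis
        using l[of "?\<psi> x \<oplus>\<^bsub>X\<^esub> ?\<psi> y"] c that by simp
    qed
    moreover have "?\<psi> (s \<odot>\<^bsub>X'\<^esub> y) = s \<odot>\<^bsub>X\<^esub> ?\<psi> y" if "s \<in> carrier R" "y \<in> carrier X'" for s y
    proof -
      have "\<phi> (s \<odot>\<^bsub>X\<^esub> ?\<psi> y) = s \<odot>\<^bsub>X'\<^esub> y"
        using \<phi>(1) that by (simp add: module_homs_def c r)
      then show ?thesis
        using l[of "s \<odot>\<^bsub>X\<^esub> ?\<psi> y"] c that by simp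
    qed
    ultimately have "?\<psi> \<in> module_homs R X' X"
      using c by (simp add: module_homs_def)
    moreover have "?\<psi> (i' b) = i b" if "b \<in> carrier B" for b
      using \<phi>(3)[OF that] l[OF i[OF that]] by simp
    moreover have "p (?\<psi> y) = p' y" if "y \<in> carrier X'" for y
      using \<phi>(4)[OF c[OF that]] r[OF that] by simp
    ultimately have "ext_equivalent R A B (X', i', p') (X, i, p)"
      using b by (auto simp: ext_equivalent_def)
    then show "(E', E) \<in> ext_rel R A B"
      using se by (simp add: ext_rel_def E)
  qed
  show "trans (ext_rel R A B)"
  proof (rule transI)
    fix E E' E'' assume rel: "(E, E') \<in> ext_rel R A B" "(E', E'') \<in> ext_rel R A B"
    obtain X i p X' i' p' X'' i'' p'' where
      E: "E = (X, i, p)" "E' = (X', i', p')" "E'' = (X'', i'', p'')"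
      by (metis prod_cases3)
    have "ext_equivalent R A B (X, i, p) (X', i', p')" "ext_equivalent R A B (X', i', p') (X'', i'', p'')"
      using rel by (auto simp: ext_rel_def E)
    then obtain \<phi> \<psi> where \<phi>: "\<phi> \<in> module_homs R X X'" "bij_betw \<phi> (carrier X) (carrier X')"
      "\<And>b. b \<in> carrier B \<Longrightarrow> \<phi> (i b) = i' b" "\<And>x. x \<in> carrier X \<Longrightarrow> p' (\<phi> x) = p x"
      and \<psi>: "\<psi> \<in> module_homs R X' X''" "bij_betw \<psi> (carrier X') (carrier X'')"
      "\<And>b. b \<in> carrier B \<Longrightarrow> \<psi> (i' b) = i'' b" "\<And>x. x \<in> carrier X' \<Longrightarrow> p'' (\<psi> x) = p' x"
      by (auto simp: ext_equivalent_def)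
    have c: "\<phi> x \<in> carrier X'" if "x \<in> carrier X" for x
      using \<phi>(1) that by (auto simp: module_homs_def)
    have "\<psi> \<circ> \<phi> \<in> module_homs R X X''"
      using \<phi>(1) \<psi>(1) by (auto simp: module_homs_def Pi_iff)
    moreover have "bij_betw (\<psi> \<circ> \<phi>) (carrier X) (carrier X'')"
      using \<phi>(2) \<psi>(2) by (rule bij_betw_trans)
    ultimately have "ext_equivalent R A B (X, i, p) (X'', i'', p'')"
      using \<phi>(3,4) \<psi>(3,4) c
      unfolding ext_equivalent_def prod.case by (intro bexI[of _ "\<psi> \<circ> \<phi>"] conjI ballI) simp_all
    then show "(E, E'') \<in> ext_rel R A B"
      using rel by (simp add: ext_rel_def E)
  qed
qed

lemma transport_extension:
  fixes X :: "('a, 'e) module" and f :: "'e \<Rightarrow> 'f"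
  assumes se: "(X, i, p) \<in> short_exact_sequences R A B" and f: "inj_on f (carrier X)"
  shows "\<exists>X' :: ('a, 'f) module. \<exists>i' p'.
    (X', i', p') \<in> short_exact_sequences R A B \<and>
    ext_equivalent R A B (X, i, p) (X', i', p')"
proof -
  interpret X: module R X using se by (simp add: short_exact_sequences_def)
  define g where "g = inv_into (carrier X) f"
  define X' :: "('a, 'f) module" where "X' =
    \<lparr>carrier = f ` carrier X, mult = undefined, one = undefined, zero = f \<zero>\<^bsub>X\<^esub>,
     add = (\<lambda>u v. f (g u \<oplus>\<^bsub>X\<^esub> g v)), smult = (\<lambda>r u. f (r \<odot>\<^bsub>X\<^esub> g u))\<rparr>"
  have gf: "g (f x) = x" if "x \<in> carrier X" for x
    using f that by (simp add: g_def)
  have "module R X'"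
  proof (rule moduleI)
    show "cring R" by (rule X.R.cring_axioms)
    show "abelian_group X'"
    proof (rule abelian_groupI)
      fix x assume "x \<in> carrier X'"
      then obtain y where "x = f y" "y \<in> carrier X" by (auto simp: X'_def)
      then show "\<exists>y\<in>carrier X'. y \<oplus>\<^bsub>X'\<^esub> x = \<zero>\<^bsub>X'\<^esub>"
        by (intro bexI[of _ "f (\<ominus>\<^bsub>X\<^esub> y)"]) (auto simp: X'_def gf X.l_neg)
    qed (auto simp: X'_def gf X.a_ac)
  qed (auto simp: X'_def gf X.smult_l_distr X.smult_r_distr X.smult_assoc1)
  moreover have "f \<circ> i \<in> module_homs R B X'"
    using se by (auto simp: short_exact_sequences_def module_homs_def X'_def Pi_iff gf)
  moreover have "p \<circ> g \<in> module_homs R X' A"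
    using se by (auto simp: short_exact_sequences_def module_homs_def X'_def Pi_iff gf)
  moreover have "inj_on (f \<circ> i) (carrier B)"
    using se f by (intro comp_inj_on)
      (auto simp: short_exact_sequences_def a_kernel_def kernel_def elim!: inj_on_subset)
  moreover have "(f \<circ> i) ` carrier B = a_kernel X' A (p \<circ> g)"
  proof -
    have "(f \<circ> i) ` carrier B = f ` a_kernel X A p"
      unfolding image_comp[symmetric] using se by (simp add: short_exact_sequences_def)
    also have "\<dots> = a_kernel X' A (p \<circ> g)"
      by (auto simp: a_kernel_def kernel_def X'_def gf)
    finally show ?thesis .
  qed
  moreover have "(p \<circ> g) ` carrier X' = carrier A"
  proof -
    have "(p \<circ> g) ` carrier X' = p ` carrier X"
      by (simp add: X'_def image_image gf)
    then show ?thesis using se by (simp add: short_exact_sequences_def)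
  qed
  ultimately have 1: "(X', f \<circ> i, p \<circ> g) \<in> short_exact_sequences R A B"
    by (simp add: short_exact_sequences_def)
  have "f \<in> module_homs R X X'" "bij_betw f (carrier X) (carrier X')"
    using f by (auto simp: module_homs_def X'_def gf bij_betw_def)
  then have "ext_equivalent R A B (X, i, p) (X', f \<circ> i, p \<circ> g)"
    by (auto simp: ext_equivalent_def gf)
  with 1 show ?thesis by blast
qed

lemma extension_representative:
  fixes X :: "('a, 'e) module" and i :: "'b \<Rightarrow> 'e" and p :: "'e \<Rightarrow> 'c"
  assumes "module R A" "module R B" and se: "(X, i, p) \<in> short_exact_sequences R A B"
  shows "\<exists>X' :: ('a, 'b \<times> 'c) module. \<exists>i' p'.
    (X', i', p') \<in> short_exact_sequences R A B \<and>
    ext_equivalent R A B (X, i, p) (X', i', p')"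
proof -
  interpret A: module R A by fact
  interpret X: module R X using se by (simp add: short_exact_sequences_def)
  have p: "p x \<in> carrier A" "p (x \<oplus>\<^bsub>X\<^esub> y) = p x \<oplus>\<^bsub>A\<^esub> p y" if "x \<in> carrier X" "y \<in> carrier X" for x y
    using se that by (auto simp: short_exact_sequences_def module_homs_def)
  have p0: "p \<zero>\<^bsub>X\<^esub> = \<zero>\<^bsub>A\<^esub>"
    using p[OF X.zero_closed X.zero_closed] by (metis A.add.r_cancel_one X.l_zero X.zero_closed)
  define s where "s = inv_into (carrier X) p"
  have s: "s (p x) \<in> carrier X" "p (s (p x)) = p x" if "x \<in> carrier X" for x
    using that by (auto simp: s_def inv_into_into f_inv_into_f)
  define d where "d x = x \<ominus>\<^bsub>X\<^esub> s (p x)" for x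
  have d: "d x \<in> i ` carrier B" if x: "x \<in> carrier X" for x
  proof -
    have "p (\<ominus>\<^bsub>X\<^esub> s (p x)) \<oplus>\<^bsub>A\<^esub> p x = \<zero>\<^bsub>A\<^esub>"
      using p(2)[of "\<ominus>\<^bsub>X\<^esub> s (p x)" "s (p x)"] s[OF x] by (simp add: X.l_neg p0)
    then have "d x \<in> a_kernel X A p"
      using x s[OF x] p by (simp add: a_kernel_def kernel_def d_def X.minus_eq A.a_comm)
    then show ?thesis using se by (simp add: short_exact_sequences_def)
  qed
  have "inj_on (\<lambda>x. (inv_into (carrier B) i (d x), p x)) (carrier X)"
  proof (rule inj_onI)
    fix x y assume xy: "x \<in> carrier X" "y \<in> carrier X"
      and eq: "(inv_into (carrier B) i (d x), p x) = (inv_into (carrier B) i (d y), p y)"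
    have "d x = d y"
      using eq d xy by (metis (no_types, lifting) Pair_inject inv_into_injective)
    then show "x = y"
      using eq xy s[of x] by (simp add: d_def X.minus_eq)
  qed
  from transport_extension[OF se this] show ?thesis .
qed

end

theory Submission
  imports Defs
begin

text \<open>
  If \<open>\<mm> x \<subseteq> \<mm> N\<close> and \<open>x \<notin> N\<close>, put \<open>X = N + R x\<close>. Then \<open>X / N\<close> is the residue field and
  \<open>\<mm> X = \<mm> N\<close>, so \<open>X\<close> needs exactly one generator more than \<open>N\<close> and the extension
  \<open>0 \<rightarrow> N \<rightarrow> X \<rightarrow> k \<rightarrow> 0\<close> represents an element of \<open>Ext\<^sup>1(k, N)\<^sup>\<mu>\<close>. By hypothesis it splits; the
  image of the class of \<open>x\<close> under a splitting is an element of the socle congruent to \<open>x\<close> modulo \<open>N\<close>.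
  Positive depth makes the socle zero, as \<open>\<mm>\<close> then contains a nonzerodivisor on \<open>M\<close>.
\<close>

section \<open>Units of a Noetherian local ring\<close>

text \<open>Over the residue field, the extra generator of X is a dimension count. Here generators
  are counted directly as finite spanning sets, so the count becomes an exchange argument that rests
  on Nakayama's lemma. The hard half is the lower bound: generators of X must yield generators of N
  with one element fewer, and for this m x has to lie in mN and not merely in N. A second obstacle
  is the type of the middle term. Members of \<open>Ext1\<close> are classes of extensions carried
  by the product type of N and k, whereas X is a subset of M. So X is replaced by an equivalent copy
  before the hypothesis applies, and its number of generators is carried along the
  isomorphism.\<close>

lemma (in noetherian_ring) exists_maximalideal_above:
  assumes "ideal I R" "I \<noteq> carrier R"
  shows "\<exists>J. maximalideal J R \<and> I \<subseteq> J"
proof -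
  define P where "P = {J. ideal J R \<and> I \<subseteq> J \<and> J \<noteq> carrier R}"
  have "\<exists>J\<in>P. \<forall>K\<in>P. J \<subseteq> K \<longrightarrow> K = J"
  proof (rule subset_Zorn)
    fix C assume C: "subset.chain P C"
    show "\<exists>U\<in>P. \<forall>K\<in>C. K \<subseteq> U"
    proof (cases "C = {}")
      case True
      then show ?thesis using assms by (auto simp: P_def)
    next
      case False
      \<comment> \<open>In a Noetherian ring a nonempty chain of ideals contains its own union, so
        the upper bound is automatically a proper ideal.\<close>
      have "subset.chain {J. ideal J R} C"
        using C by (auto simp: subset.chain_def P_def)
      then have "\<Union>C \<in> C" by (rule ideal_chain_is_trivial[OF False])
      then show ?thesis using C by (auto simp: subset.chain_def)
    qed
  qed
  then obtain J where J: "J \<in> P" "\<And>K. K \<in> P \<Longrightarrow> J \<subseteq> K \<Longrightarrow> K = J" by blast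
  have "maximalideal J R"
    using J by (intro maximalidealI) (auto simp: P_def)
  then show ?thesis using J by (auto simp: P_def)
qed

text \<open>A nonunit generates a proper principal ideal; a maximal ideal above it can only be
  \<open>\<mm>\<close>.\<close>

lemma (in noetherian_local_ring) non_maximal_Units:
  assumes "a \<in> carrier R" "a \<notin> \<mm>"
  shows "a \<in> Units R"
proof (rule ccontr)
  assume a: "a \<notin> Units R"
  have "PIdl a \<noteq> carrier R"
  proof
    assume "PIdl a = carrier R"
    then have "\<one> \<in> PIdl a" by simp
    then obtain b where b: "b \<in> carrier R" "b \<otimes> a = \<one>"
      unfolding cgenideal_def by force
    then have "a \<otimes> b = \<one>" using assms(1) by (simp add: m_comm)
    then show False using a b assms(1) unfolding Units_def by blast
  qed
  then obtain J where "maximalideal J R" "PIdl a \<subseteq> J"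
    using exists_maximalideal_above cgenideal_ideal[OF assms(1)] by blast
  then show False
    using maximalideal_unique cgenideal_self[OF assms(1)] assms(2) by blast
qed

lemma (in noetherian_local_ring) one_notin_maximal: "\<one> \<notin> \<mm>"
  using I_notcarr one_imp_carrier by metis

lemma (in noetherian_local_ring) one_minus_maximal_Units:
  assumes "a \<in> \<mm>"
  shows "\<one> \<ominus> a \<in> Units R"
proof (rule non_maximal_Units)
  have a: "a \<in> carrier R" using assms by (rule a_Hcarr)
  then show "\<one> \<ominus> a \<in> carrier R" by simp
  show "\<one> \<ominus> a \<notin> \<mm>"
  proof
    assume "\<one> \<ominus> a \<in> \<mm>"
    then have "(\<one> \<ominus> a) \<oplus> a \<in> \<mm>" using assms by simp
    then show False using a one_notin_maximal by (simp add: minus_eq a_assoc l_neg)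
  qed
qed

section \<open>Spans\<close>

lemma (in abelian_group) a_inv_zero: "\<ominus> \<zero> = \<zero>"
  by (rule minus_equality) auto

context module
begin

lemma submodule_zero: "submodule H R M \<Longrightarrow> \<zero>\<^bsub>M\<^esub> \<in> H"
  by (auto simp: submodule_def dest: subgroup.one_closed)

lemma submodule_minus:
  "submodule H R M \<Longrightarrow> x \<in> H \<Longrightarrow> y \<in> H \<Longrightarrow> x \<ominus>\<^bsub>M\<^esub> y \<in> H"
  using submoduleE(3,5) by (auto simp: M.minus_eq)

text \<open>Negatives come from scalar multiplication by -1, so closure under them need not be
  checked each time.\<close>

lemma submodule_smultI:
  assumes "H \<subseteq> carrier M" "\<zero>\<^bsub>M\<^esub> \<in> H"
    and "\<And>x y. x \<in> H \<Longrightarrow> y \<in> H \<Longrightarrow> x \<oplus>\<^bsub>M\<^esub> y \<in> H"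
    and "\<And>a x. a \<in> carrier R \<Longrightarrow> x \<in> H \<Longrightarrow> a \<odot>\<^bsub>M\<^esub> x \<in> H"
  shows "submodule H R M"
proof (rule submoduleI)
  show "\<ominus>\<^bsub>M\<^esub> x \<in> H" if "x \<in> H" for x
  proof -
    have "(\<ominus> \<one>) \<odot>\<^bsub>M\<^esub> x \<in> H" using that by (intro assms(4)) auto
    then show ?thesis using that assms(1) smult_l_minus[of \<one> x] by auto
  qed
qed (use assms in auto)

lemma submodule_restrict:
  assumes "submodule N R M"
  shows "submodule H R (M\<lparr>carrier := N\<rparr>) \<longleftrightarrow> submodule H R M \<and> H \<subseteq> N"
proof -
  have N: "module R (M\<lparr>carrier := N\<rparr>)"
    using assms module_axioms by (rule submodule.submodule_is_module)
  show ?thesis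
  proof (intro iffI conjI)
    assume H: "submodule H R (M\<lparr>carrier := N\<rparr>)"
    show "H \<subseteq> N" using module.submoduleE(1)[OF N H] by simp
    moreover have "module R (M\<lparr>carrier := H\<rparr>)"
      using submodule.submodule_is_module[OF H N] by simp
    ultimately show "submodule H R M"
      using submoduleE(1)[OF assms] by (intro module_incl_imp_submodule) auto
  next
    assume H: "submodule H R M \<and> H \<subseteq> N"
    then have "module R (M\<lparr>carrier := H\<rparr>)"
      using submodule.submodule_is_module module_axioms by blast
    then show "submodule H R (M\<lparr>carrier := N\<rparr>)"
      using H by (intro module.module_incl_imp_submodule[OF N]) auto
  qed
qed

lemma mod_span_minimal: "submodule N R M \<Longrightarrow> S \<subseteq> N \<Longrightarrow> mod_span R M S \<subseteq> N"
  by (auto simp: mod_span_def)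

lemma mod_span_superset: "S \<subseteq> mod_span R M S"
  by (auto simp: mod_span_def)

lemma mod_span_closed: "S \<subseteq> carrier M \<Longrightarrow> mod_span R M S \<subseteq> carrier M"
  by (intro mod_span_minimal carrier_is_submodule)

lemma mod_span_mono: "S \<subseteq> T \<Longrightarrow> mod_span R M S \<subseteq> mod_span R M T"
  by (auto simp: mod_span_def)

text \<open>Lets generating sets of N and of X, which are counted inside modules such as
  \<open>M\<lparr>carrier := N\<rparr>\<close>, be handled as subsets of the one module M.\<close>

lemma mod_span_restrict:
  assumes "submodule N R M" "S \<subseteq> N"
  shows "mod_span R (M\<lparr>carrier := N\<rparr>) S = mod_span R M S"
proof
  show "mod_span R (M\<lparr>carrier := N\<rparr>) S \<subseteq> mod_span R M S"
  proof -
    have "submodule (mod_span R M S) R (M\<lparr>carrier := N\<rparr>)"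
      using assms submoduleE(1)[OF assms(1)]
      by (auto simp: submodule_restrict intro!: mod_span_submodule dest: mod_span_minimal)
    then show ?thesis
      using mod_span_superset by (auto simp: mod_span_def[of _ "M\<lparr>carrier := N\<rparr>"])
  qed
  show "mod_span R M S \<subseteq> mod_span R (M\<lparr>carrier := N\<rparr>) S"
    using submodule_restrict[OF assms(1)] by (auto simp: mod_span_def)
qed

lemma mod_span_empty: "mod_span R M {} = {\<zero>\<^bsub>M\<^esub>}"
proof
  have "submodule {\<zero>\<^bsub>M\<^esub>} R M" by (rule submoduleI) auto
  then show "mod_span R M {} \<subseteq> {\<zero>\<^bsub>M\<^esub>}" by (rule mod_span_minimal) auto
  show "{\<zero>\<^bsub>M\<^esub>} \<subseteq> mod_span R M {}"
    using submodule_zero[OF mod_span_submodule[of "{}"]] by auto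
qed

lemma mem_set_addI: "h \<in> H \<Longrightarrow> k \<in> K \<Longrightarrow> h \<oplus>\<^bsub>M\<^esub> k \<in> H <+>\<^bsub>M\<^esub> K"
  by (auto simp: set_add_def')

lemma submodule_sum:
  assumes H: "submodule H R M" and K: "submodule K R M"
  shows "submodule (H <+>\<^bsub>M\<^esub> K) R M"
proof (rule submodule_smultI)
  note car = submoduleE(1)[OF H] submoduleE(1)[OF K]
  show "H <+>\<^bsub>M\<^esub> K \<subseteq> carrier M" using car by (auto simp: set_add_def')
  show "\<zero>\<^bsub>M\<^esub> \<in> H <+>\<^bsub>M\<^esub> K"
    using H K by (auto simp: set_add_def' intro!: bexI[of _ "\<zero>\<^bsub>M\<^esub>"] submodule_zero)
  show "x \<oplus>\<^bsub>M\<^esub> y \<in> H <+>\<^bsub>M\<^esub> K" if "x \<in> H <+>\<^bsub>M\<^esub> K" "y \<in> H <+>\<^bsub>M\<^esub> K" for x y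
  proof -
    obtain h k h' k' where hk: "h \<in> H" "k \<in> K" "x = h \<oplus>\<^bsub>M\<^esub> k" "h' \<in> H" "k' \<in> K" "y = h' \<oplus>\<^bsub>M\<^esub> k'"
      using \<open>x \<in> _\<close> \<open>y \<in> _\<close> by (auto simp: set_add_def')
    then have "h \<in> carrier M" "k \<in> carrier M" "h' \<in> carrier M" "k' \<in> carrier M" using car by auto
    then have "x \<oplus>\<^bsub>M\<^esub> y = (h \<oplus>\<^bsub>M\<^esub> h') \<oplus>\<^bsub>M\<^esub> (k \<oplus>\<^bsub>M\<^esub> k')" using hk by (simp add: M.a_ac)
    moreover have "h \<oplus>\<^bsub>M\<^esub> h' \<in> H" "k \<oplus>\<^bsub>M\<^esub> k' \<in> K"
      using hk submoduleE(5)[OF H] submoduleE(5)[OF K] by auto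
    ultimately show ?thesis by (simp add: mem_set_addI)
  qed
  show "a \<odot>\<^bsub>M\<^esub> x \<in> H <+>\<^bsub>M\<^esub> K" if a: "a \<in> carrier R" and x: "x \<in> H <+>\<^bsub>M\<^esub> K" for a x
  proof -
    obtain h k where hk: "h \<in> H" "k \<in> K" "x = h \<oplus>\<^bsub>M\<^esub> k" using x by (auto simp: set_add_def')
    then have "h \<in> carrier M" "k \<in> carrier M" using car by auto
    then have "a \<odot>\<^bsub>M\<^esub> x = a \<odot>\<^bsub>M\<^esub> h \<oplus>\<^bsub>M\<^esub> a \<odot>\<^bsub>M\<^esub> k" using hk(3) a by (simp add: smult_r_distr)
    then show ?thesis using hk a submoduleE(4)[OF H] submoduleE(4)[OF K] by (simp add: mem_set_addI)
  qed
qed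

text \<open>The cyclic module R t and its submodule m t are the two instances of interest. For a
  single t and an ideal \<open>I\<close> the products already form a submodule, so no span is
  taken.\<close>

definition multiples :: "'a set \<Rightarrow> 'c \<Rightarrow> 'c set"
  where "multiples I t = {a \<odot>\<^bsub>M\<^esub> t | a. a \<in> I}"

lemma multiples_submodule:
  assumes I: "ideal I R" and t: "t \<in> carrier M"
  shows "submodule (multiples I t) R M"
proof -
  interpret I: ideal I R by fact
  show ?thesis
  proof (rule submodule_smultI)
    show "multiples I t \<subseteq> carrier M" using t by (auto simp: multiples_def)
    show "\<zero>\<^bsub>M\<^esub> \<in> multiples I t"
      using t I.zero_closed by (force simp: multiples_def intro!: exI[of _ "\<zero>"])
    show "x \<oplus>\<^bsub>M\<^esub> y \<in> multiples I t" if "x \<in> multiples I t" "y \<in> multiples I t" for x y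
    proof -
      obtain a b where a: "a \<in> I" "b \<in> I" "x = a \<odot>\<^bsub>M\<^esub> t" "y = b \<odot>\<^bsub>M\<^esub> t"
        using \<open>x \<in> _\<close> \<open>y \<in> _\<close> by (auto simp: multiples_def)
      then have "x \<oplus>\<^bsub>M\<^esub> y = (a \<oplus> b) \<odot>\<^bsub>M\<^esub> t" "a \<oplus> b \<in> I" using t by (auto simp: smult_l_distr)
      then show ?thesis by (auto simp: multiples_def)
    qed
    show "a \<odot>\<^bsub>M\<^esub> x \<in> multiples I t" if "a \<in> carrier R" "x \<in> multiples I t" for a x
    proof -
      obtain b where b: "b \<in> I" "x = b \<odot>\<^bsub>M\<^esub> t" using \<open>x \<in> _\<close> by (auto simp: multiples_def)
      then have "a \<odot>\<^bsub>M\<^esub> x = (a \<otimes> b) \<odot>\<^bsub>M\<^esub> t" "a \<otimes> b \<in> I"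
        using that(1) t by (auto simp: smult_assoc1 I.I_l_closed)
      then show ?thesis by (auto simp: multiples_def)
    qed
  qed
qed

text \<open>Stands in for finite linear combinations: an element of a span is split into a multiple
  of one chosen generator and a rest. The inductions over finite generating sets consume spans in
  this form.\<close>

lemma mod_span_insert:
  assumes "t \<in> carrier M" "S \<subseteq> carrier M"
  shows "mod_span R M (insert t S) = multiples (carrier R) t <+>\<^bsub>M\<^esub> mod_span R M S"
proof
  note sub = multiples_submodule[OF R.oneideal assms(1)] mod_span_submodule[OF assms(2)]
  have t: "t \<in> multiples (carrier R) t"
    using assms(1) by (auto simp: multiples_def intro!: exI[of _ "\<one>"])
  have "t \<in> multiples (carrier R) t <+>\<^bsub>M\<^esub> mod_span R M S"
    using t submodule_zero[OF sub(2)] assms(1) by (force simp: set_add_def')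
  moreover have "S \<subseteq> multiples (carrier R) t <+>\<^bsub>M\<^esub> mod_span R M S"
    using submodule_zero[OF sub(1)] mod_span_superset[of S] assms(2) by (force simp: set_add_def')
  ultimately show "mod_span R M (insert t S) \<subseteq> multiples (carrier R) t <+>\<^bsub>M\<^esub> mod_span R M S"
    using sub by (intro mod_span_minimal submodule_sum) auto
  have S: "submodule (mod_span R M (insert t S)) R M"
    using assms by (intro mod_span_submodule) auto
  have "mod_span R M S \<subseteq> mod_span R M (insert t S)" by (rule mod_span_mono) auto
  moreover have "multiples (carrier R) t \<subseteq> mod_span R M (insert t S)"
    using mod_span_superset[of "insert t S"] submoduleE(4)[OF S] by (auto simp: multiples_def)
  ultimately show "multiples (carrier R) t <+>\<^bsub>M\<^esub> mod_span R M S \<subseteq> mod_span R M (insert t S)"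
    using submoduleE(5)[OF S] by (auto simp: set_add_def')
qed

lemma ideal_smult_submodule:
  assumes "I \<subseteq> carrier R" "N \<subseteq> carrier M"
  shows "submodule (ideal_smult R M I N) R M"
  unfolding ideal_smult_def using assms by (intro mod_span_submodule) auto

lemma ideal_smult_mem: "a \<in> I \<Longrightarrow> x \<in> N \<Longrightarrow> a \<odot>\<^bsub>M\<^esub> x \<in> ideal_smult R M I N"
  unfolding ideal_smult_def by (rule subsetD[OF mod_span_superset]) auto

lemma ideal_smult_minimal:
  assumes "submodule H R M" "\<And>a x. a \<in> I \<Longrightarrow> x \<in> N \<Longrightarrow> a \<odot>\<^bsub>M\<^esub> x \<in> H"
  shows "ideal_smult R M I N \<subseteq> H"
  unfolding ideal_smult_def using assms by (intro mod_span_minimal) auto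

section \<open>Finite generation and Nakayama's lemma\<close>

text \<open>This is the ideal (W + K : s). When K is spanned by the remaining generators, it
  consists of the s-coordinates of elements of W and plays the part of a leading coefficient
  ideal.\<close>

lemma transporter_ideal:
  assumes W: "submodule W R M" and K: "submodule K R M" and s: "s \<in> carrier M"
  shows "ideal {b \<in> carrier R. \<exists>w\<in>W. w \<ominus>\<^bsub>M\<^esub> b \<odot>\<^bsub>M\<^esub> s \<in> K} R" (is "ideal ?I R")
proof -
  note car = subsetD[OF submoduleE(1)[OF W]]
  have l: "a \<otimes> b \<in> ?I" if "b \<in> ?I" "a \<in> carrier R" for a b
  proof -
    obtain w where w: "w \<in> W" "w \<ominus>\<^bsub>M\<^esub> b \<odot>\<^bsub>M\<^esub> s \<in> K" and b: "b \<in> carrier R" using \<open>b \<in> ?I\<close> by auto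
    have "a \<odot>\<^bsub>M\<^esub> (w \<ominus>\<^bsub>M\<^esub> b \<odot>\<^bsub>M\<^esub> s) = a \<odot>\<^bsub>M\<^esub> w \<ominus>\<^bsub>M\<^esub> (a \<otimes> b) \<odot>\<^bsub>M\<^esub> s"
      using w b s that car by (simp add: M.minus_eq smult_r_distr smult_r_minus smult_assoc1)
    moreover have "a \<odot>\<^bsub>M\<^esub> (w \<ominus>\<^bsub>M\<^esub> b \<odot>\<^bsub>M\<^esub> s) \<in> K"
      by (rule submoduleE(4)[OF K that(2) w(2)])
    ultimately show ?thesis
      using b that(2) submoduleE(4)[OF W that(2) w(1)] by (intro CollectI conjI bexI) auto
  qed
  show ?thesis
  proof (rule idealI)
    show "ring R" by (rule R.ring_axioms)
    show "subgroup ?I (add_monoid R)"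
    proof (rule R.add.subgroupI)
      show "?I \<subseteq> carrier R" by auto
      have "\<zero> \<in> ?I"
        using s submodule_zero[OF W] submoduleE(3)[OF K submodule_zero[OF K]]
        by (auto simp: M.minus_eq intro!: bexI[of _ "\<zero>\<^bsub>M\<^esub>"])
      then show "?I \<noteq> {}" by blast
      show "\<ominus> b \<in> ?I" if "b \<in> ?I" for b
      proof -
        have "(\<ominus> \<one>) \<otimes> b \<in> ?I" using that by (intro l) auto
        moreover have "(\<ominus> \<one>) \<otimes> b = \<ominus> b" using that by (simp add: R.l_minus)
        ultimately show ?thesis by simp
      qed
      show "b \<oplus> b' \<in> ?I" if "b \<in> ?I" "b' \<in> ?I" for b b'
      proof -
        obtain w w' where w: "w \<in> W" "w \<ominus>\<^bsub>M\<^esub> b \<odot>\<^bsub>M\<^esub> s \<in> K" "w' \<in> W" "w' \<ominus>\<^bsub>M\<^esub> b' \<odot>\<^bsub>M\<^esub> s \<in> K"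
          and b: "b \<in> carrier R" "b' \<in> carrier R" using \<open>b \<in> ?I\<close> \<open>b' \<in> ?I\<close> by auto
        have "(w \<oplus>\<^bsub>M\<^esub> w') \<ominus>\<^bsub>M\<^esub> (b \<oplus> b') \<odot>\<^bsub>M\<^esub> s
            = (w \<ominus>\<^bsub>M\<^esub> b \<odot>\<^bsub>M\<^esub> s) \<oplus>\<^bsub>M\<^esub> (w' \<ominus>\<^bsub>M\<^esub> b' \<odot>\<^bsub>M\<^esub> s)"
          using w b s car by (simp add: M.minus_eq smult_l_distr M.minus_add M.a_ac)
        moreover have "(w \<ominus>\<^bsub>M\<^esub> b \<odot>\<^bsub>M\<^esub> s) \<oplus>\<^bsub>M\<^esub> (w' \<ominus>\<^bsub>M\<^esub> b' \<odot>\<^bsub>M\<^esub> s) \<in> K"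
          by (rule submoduleE(5)[OF K w(2) w(4)])
        ultimately show ?thesis
          using b submoduleE(5)[OF W w(1) w(3)] by (intro CollectI conjI bexI) auto
      qed
    qed
    fix a x assume "a \<in> ?I" "x \<in> carrier R"
    then show "x \<otimes> a \<in> ?I" by (rule l)
    then show "a \<otimes> x \<in> ?I" using \<open>a \<in> ?I\<close> \<open>x \<in> carrier R\<close> by (simp add: R.m_comm)
  qed
qed

end

text \<open>Induction on the number of generators of the ambient span: N is generated by generators
  of its intersection with the smaller span \<open>?K\<close>, together with lifts of finitely many
  generators of its ideal of s-coordinates.\<close>

lemma submodule_fin_gen:
  assumes "noetherian_ring R" "module R M"
    and "finite S" "S \<subseteq> carrier M" "submodule N R M" "N \<subseteq> mod_span R M S"
  shows "\<exists>T. finite T \<and> T \<subseteq> N \<and> mod_span R M T = N"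
proof -
  interpret R: noetherian_ring R by fact
  interpret module R M by fact
  show ?thesis
    using assms(3-6)
  proof (induction S arbitrary: N)
    case empty
    then have "mod_span R M {} = N"
      using submodule_zero[of N] by (auto simp: mod_span_empty)
    then show ?case by blast
  next
    case (insert s S)
    let ?K = "mod_span R M S"
    have s: "s \<in> carrier M" and S: "S \<subseteq> carrier M" using insert.prems by auto
    have K: "submodule ?K R M" by (rule mod_span_submodule[OF S])
    note N = insert.prems(2)
    have Ncar: "n \<in> carrier M" if "n \<in> N" for n using submoduleE(1)[OF N] that by auto
    have Kcar: "n \<in> carrier M" if "n \<in> ?K" for n using submoduleE(1)[OF K] that by auto
    let ?I = "\<lambda>W. {b \<in> carrier R. \<exists>w\<in>W. w \<ominus>\<^bsub>M\<^esub> b \<odot>\<^bsub>M\<^esub> s \<in> ?K}"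
    obtain A where A: "A \<subseteq> carrier R" "finite A" "?I N = Idl\<^bsub>R\<^esub> A"
      using R.finetely_gen[OF transporter_ideal[OF N K s]] by blast
    have "\<forall>a\<in>A. \<exists>w. w \<in> N \<and> w \<ominus>\<^bsub>M\<^esub> a \<odot>\<^bsub>M\<^esub> s \<in> ?K"
      using R.genideal_self[OF A(1)] A(3)[symmetric] by auto
    then obtain f where f: "\<And>a. a \<in> A \<Longrightarrow> f a \<in> N" "\<And>a. a \<in> A \<Longrightarrow> f a \<ominus>\<^bsub>M\<^esub> a \<odot>\<^bsub>M\<^esub> s \<in> ?K"
      by metis
    have "submodule (N \<inter> ?K) R M"
      using submoduleE[OF N] submoduleE[OF K] submodule_zero[OF N] submodule_zero[OF K]
      by (intro submoduleI) auto
    then obtain T where T: "finite T" "T \<subseteq> N \<inter> ?K" "mod_span R M T = N \<inter> ?K"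
      using insert.IH[OF S, of "N \<inter> ?K"] by auto
    let ?W = "mod_span R M (f ` A)" and ?U = "mod_span R M (T \<union> f ` A)"
    have "f ` A \<subseteq> carrier M" "T \<union> f ` A \<subseteq> carrier M" using f(1) T(2) Ncar by auto
    note W = mod_span_submodule[OF this(1)] and U = mod_span_submodule[OF this(2)]
    have WN: "?W \<subseteq> N" using f(1) by (intro mod_span_minimal N) auto
    \<comment> \<open>The s-coordinates of \<open>?W\<close> form an ideal that contains the
      generators \<open>A\<close>, hence all of \<open>?I N\<close>. This gives every element of N a
      partner in \<open>?W\<close> with the same s-coordinate, without combining the lifts
      explicitly.\<close>
    have "A \<subseteq> ?I ?W"
    proof
      fix a assume a: "a \<in> A"
      then have "f a \<in> ?W" using mod_span_superset[of "f ` A"] by blast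
      then show "a \<in> ?I ?W" using a A(1) f(2) by blast
    qed
    then have IW: "?I N \<subseteq> ?I ?W"
      unfolding A(3) by (intro R.genideal_minimal transporter_ideal W K s)
    have "N \<subseteq> ?U"
    proof
      fix n assume n: "n \<in> N"
      then have "n \<in> multiples (carrier R) s <+>\<^bsub>M\<^esub> ?K"
        using insert.prems(3) mod_span_insert[OF s S] by auto
      then obtain b y where b: "b \<in> carrier R" "y \<in> ?K" "n = b \<odot>\<^bsub>M\<^esub> s \<oplus>\<^bsub>M\<^esub> y"
        by (auto simp: set_add_def' multiples_def)
      have "n \<ominus>\<^bsub>M\<^esub> b \<odot>\<^bsub>M\<^esub> s = y"
        using b s Kcar by (simp add: M.minus_eq M.a_ac M.r_neg)
      then have "b \<in> ?I N" using b(1,2) n by force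
      then obtain w where w: "w \<in> ?W" "w \<ominus>\<^bsub>M\<^esub> b \<odot>\<^bsub>M\<^esub> s \<in> ?K" using IW by auto
      have wc: "w \<in> carrier M" using w WN Ncar by auto
      have "n \<ominus>\<^bsub>M\<^esub> w = y \<ominus>\<^bsub>M\<^esub> (w \<ominus>\<^bsub>M\<^esub> b \<odot>\<^bsub>M\<^esub> s)"
        using b s Kcar wc by (simp add: M.minus_eq M.minus_add M.a_ac)
      then have "n \<ominus>\<^bsub>M\<^esub> w \<in> ?K" using submodule_minus[OF K b(2) w(2)] by simp
      moreover have "n \<ominus>\<^bsub>M\<^esub> w \<in> N" using submodule_minus[OF N n] w(1) WN by blast
      ultimately have "n \<ominus>\<^bsub>M\<^esub> w \<in> ?U"
        using T(3) mod_span_mono[of T "T \<union> f ` A"] by auto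
      moreover have "w \<in> ?U" using w mod_span_mono[of "f ` A" "T \<union> f ` A"] by auto
      ultimately have "(n \<ominus>\<^bsub>M\<^esub> w) \<oplus>\<^bsub>M\<^esub> w \<in> ?U" by (rule submoduleE(5)[OF U])
      then show "n \<in> ?U"
        using wc n Ncar by (simp add: M.minus_eq M.a_assoc M.l_neg)
    qed
    moreover have "?U \<subseteq> N" using T(2) f(1) by (intro mod_span_minimal N) auto
    ultimately show ?case
      using T(1,2) A(2) f(1) by (intro exI[of _ "T \<union> f ` A"]) auto
  qed
qed

text \<open>Generators outside L are discarded one at a time: t is congruent modulo L to a t plus an
  element of the span of the others, with a in m, and 1 - a is a unit, so t is redundant. Dropping t
  leaves the span unchanged, so the hypothesis passes to the smaller set as it stands.\<close>

lemma nakayama: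
  assumes "noetherian_local_ring R \<mm>" "module R M"
    and "finite T" "T \<subseteq> carrier M" "submodule L R M"
    and "mod_span R M (L \<union> T) \<subseteq> L <+>\<^bsub>M\<^esub> ideal_smult R M \<mm> (mod_span R M (L \<union> T))"
  shows "mod_span R M (L \<union> T) = L"
proof -
  interpret R: noetherian_local_ring R \<mm> by fact
  interpret module R M by fact
  note L = assms(5)
  note Lcar = submoduleE(1)[OF L]
  show ?thesis
    using assms(3,4,6)
  proof (induction T)
    case empty
    then show ?case using mod_span_minimal[OF L, of L] mod_span_superset[of L] by auto
  next
    case (insert t T)
    let ?K = "mod_span R M (L \<union> T)"
    have t: "t \<in> carrier M" and LT: "L \<union> T \<subseteq> carrier M" using insert.prems Lcar by auto
    have K: "submodule ?K R M" by (rule mod_span_submodule[OF LT])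
    note Kcar = subsetD[OF submoduleE(1)[OF K]]
    have LK: "L \<subseteq> ?K" using mod_span_superset[of "L \<union> T"] by auto
    have N: "mod_span R M (L \<union> insert t T) = multiples (carrier R) t <+>\<^bsub>M\<^esub> ?K"
      using mod_span_insert[OF t LT] by simp
    \<comment> \<open>Only the coefficient of t has to stay in m; for the other summand membership
      in \<open>?K\<close> is enough.\<close>
    have "ideal_smult R M \<mm> (mod_span R M (L \<union> insert t T)) \<subseteq> multiples \<mm> t <+>\<^bsub>M\<^esub> ?K"
    proof (rule ideal_smult_minimal)
      show "submodule (multiples \<mm> t <+>\<^bsub>M\<^esub> ?K) R M"
        by (intro submodule_sum multiples_submodule R.is_ideal t K)
      fix a x assume a: "a \<in> \<mm>" and "x \<in> mod_span R M (L \<union> insert t T)"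
      then obtain b y where b: "b \<in> carrier R" "y \<in> ?K" "x = b \<odot>\<^bsub>M\<^esub> t \<oplus>\<^bsub>M\<^esub> y"
        unfolding N by (auto simp: set_add_def' multiples_def)
      have ac: "a \<in> carrier R" using a by (rule R.a_Hcarr)
      have "a \<odot>\<^bsub>M\<^esub> x = (a \<otimes>\<^bsub>R\<^esub> b) \<odot>\<^bsub>M\<^esub> t \<oplus>\<^bsub>M\<^esub> a \<odot>\<^bsub>M\<^esub> y"
        using b ac t Kcar by (simp add: smult_r_distr smult_assoc1)
      moreover have "a \<otimes>\<^bsub>R\<^esub> b \<in> \<mm>" using a b by (simp add: R.I_r_closed)
      moreover have "a \<odot>\<^bsub>M\<^esub> y \<in> ?K" using submoduleE(4)[OF K] ac b by auto
      ultimately show "a \<odot>\<^bsub>M\<^esub> x \<in> multiples \<mm> t <+>\<^bsub>M\<^esub> ?K"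
        by (auto simp: set_add_def' multiples_def)
    qed
    moreover have "t \<in> mod_span R M (L \<union> insert t T)"
      using mod_span_superset[of "L \<union> insert t T"] by auto
    ultimately have "t \<in> L <+>\<^bsub>M\<^esub> (multiples \<mm> t <+>\<^bsub>M\<^esub> ?K)"
      using insert.prems(2) by (force simp: set_add_def')
    then obtain l a y where l: "l \<in> L" "a \<in> \<mm>" "y \<in> ?K" "t = l \<oplus>\<^bsub>M\<^esub> (a \<odot>\<^bsub>M\<^esub> t \<oplus>\<^bsub>M\<^esub> y)"
      by (auto simp: set_add_def' multiples_def)
    have ac: "a \<in> carrier R" using l(2) by (rule R.a_Hcarr)
    have lc: "l \<in> carrier M" "y \<in> carrier M" using l Lcar Kcar by auto
    have "(\<one>\<^bsub>R\<^esub> \<ominus>\<^bsub>R\<^esub> a) \<odot>\<^bsub>M\<^esub> t = t \<ominus>\<^bsub>M\<^esub> a \<odot>\<^bsub>M\<^esub> t"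
      using ac t by (simp add: R.minus_eq M.minus_eq smult_l_distr smult_l_minus)
    also have "\<dots> = (a \<odot>\<^bsub>M\<^esub> t \<oplus>\<^bsub>M\<^esub> (l \<oplus>\<^bsub>M\<^esub> y)) \<ominus>\<^bsub>M\<^esub> a \<odot>\<^bsub>M\<^esub> t"
      using l(4) lc ac t M.a_lcomm[of l "a \<odot>\<^bsub>M\<^esub> t" y] by simp
    also have "\<dots> = l \<oplus>\<^bsub>M\<^esub> y"
      using lc ac t by (simp add: M.minus_eq M.a_ac M.r_neg)
    finally have 1: "(\<one>\<^bsub>R\<^esub> \<ominus>\<^bsub>R\<^esub> a) \<odot>\<^bsub>M\<^esub> t \<in> ?K"
      using l LK submoduleE(5)[OF K] by auto
    have u: "\<one>\<^bsub>R\<^esub> \<ominus>\<^bsub>R\<^esub> a \<in> Units R" by (rule R.one_minus_maximal_Units[OF l(2)])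
    let ?v = "inv\<^bsub>R\<^esub> (\<one>\<^bsub>R\<^esub> \<ominus>\<^bsub>R\<^esub> a)"
    have "?v \<odot>\<^bsub>M\<^esub> ((\<one>\<^bsub>R\<^esub> \<ominus>\<^bsub>R\<^esub> a) \<odot>\<^bsub>M\<^esub> t) = t"
      using u t ac by (simp flip: smult_assoc1)
    then have "t \<in> ?K" using submoduleE(4)[OF K R.Units_inv_closed[OF u] 1] by simp
    then have "mod_span R M (L \<union> insert t T) \<subseteq> ?K"
      using mod_span_superset[of "L \<union> T"] by (intro mod_span_minimal[OF K]) auto
    moreover have "?K \<subseteq> mod_span R M (L \<union> insert t T)" by (rule mod_span_mono) auto
    ultimately have eq: "mod_span R M (L \<union> insert t T) = ?K" by auto
    show ?case using insert.IH insert.prems unfolding eq by auto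
  qed
qed

section \<open>Minimal numbers of generators\<close>

lemma min_gens_witness:
  assumes "fin_gen_module R M"
  obtains S where "finite S" "card S = min_gens R M" "S \<subseteq> carrier M" "mod_span R M S = carrier M"
proof -
  have "\<exists>n S. finite S \<and> card S = n \<and> S \<subseteq> carrier M \<and> mod_span R M S = carrier M"
    using assms by (auto simp: fin_gen_module_def)
  from LeastI_ex[OF this] show thesis
    using that unfolding min_gens_def by blast
qed

lemma min_gens_le:
  assumes "finite S" "S \<subseteq> carrier M" "mod_span R M S = carrier M"
  shows "min_gens R M \<le> card S"
  unfolding min_gens_def using assms by (intro Least_le) blast

lemma module_homs_zero:
  assumes "module R X" "module R Y" "h \<in> module_homs R X Y"
  shows "h \<zero>\<^bsub>X\<^esub> = \<zero>\<^bsub>Y\<^esub>"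
proof -
  interpret X: module R X by fact
  interpret Y: module R Y by fact
  have "h (\<zero>\<^bsub>R\<^esub> \<odot>\<^bsub>X\<^esub> \<zero>\<^bsub>X\<^esub>) = \<zero>\<^bsub>R\<^esub> \<odot>\<^bsub>Y\<^esub> h \<zero>\<^bsub>X\<^esub>" "h \<zero>\<^bsub>X\<^esub> \<in> carrier Y"
    using assms(3) X.R.zero_closed X.zero_closed unfolding module_homs_def by blast+
  then show ?thesis by simp
qed

lemma mod_span_image:
  assumes X: "module R X" and Y: "module R Y" and h: "h \<in> module_homs R X Y" and S: "S \<subseteq> carrier X"
  shows "mod_span R Y (h ` S) = h ` mod_span R X S"
proof
  interpret X: module R X by fact
  interpret Y: module R Y by fact
  have hc: "h x \<in> carrier Y" if "x \<in> carrier X" for x using h that by (auto simp: module_homs_def)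
  have ha: "h (x \<oplus>\<^bsub>X\<^esub> y) = h x \<oplus>\<^bsub>Y\<^esub> h y" if "x \<in> carrier X" "y \<in> carrier X" for x y
    using h that by (auto simp: module_homs_def)
  have hs: "h (r \<odot>\<^bsub>X\<^esub> x) = r \<odot>\<^bsub>Y\<^esub> h x" if "r \<in> carrier R" "x \<in> carrier X" for r x
    using h that by (auto simp: module_homs_def)
  note h0 = module_homs_zero[OF X Y h]
  note H = X.mod_span_submodule[OF S]
  note Hc = subsetD[OF X.submoduleE(1)[OF H]]
  have "submodule (h ` mod_span R X S) R Y"
  proof (rule Y.submodule_smultI)
    show "h ` mod_span R X S \<subseteq> carrier Y" using hc Hc by auto
    show "\<zero>\<^bsub>Y\<^esub> \<in> h ` mod_span R X S" using X.submodule_zero[OF H] h0 by (metis imageI)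
    show "x \<oplus>\<^bsub>Y\<^esub> y \<in> h ` mod_span R X S"
      if "x \<in> h ` mod_span R X S" "y \<in> h ` mod_span R X S" for x y
      using that X.submoduleE(5)[OF H] by (auto simp: ha Hc simp flip: ha)
    show "a \<odot>\<^bsub>Y\<^esub> x \<in> h ` mod_span R X S" if "a \<in> carrier R" "x \<in> h ` mod_span R X S" for a x
      using that X.submoduleE(4)[OF H] by (auto simp: Hc simp flip: hs)
  qed
  then show "mod_span R Y (h ` S) \<subseteq> h ` mod_span R X S"
    using X.mod_span_superset[of S] by (intro Y.mod_span_minimal) auto
  have K: "submodule (mod_span R Y (h ` S)) R Y" using S hc by (intro Y.mod_span_submodule) auto
  have "submodule {x \<in> carrier X. h x \<in> mod_span R Y (h ` S)} R X"
    using Y.submodule_zero[OF K] Y.submoduleE(4,5)[OF K]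
    by (intro X.submodule_smultI) (auto simp: h0 ha hs)
  then have "mod_span R X S \<subseteq> {x \<in> carrier X. h x \<in> mod_span R Y (h ` S)}"
    using S Y.mod_span_superset[of "h ` S"] by (intro X.mod_span_minimal) auto
  then show "h ` mod_span R X S \<subseteq> mod_span R Y (h ` S)" by auto
qed

text \<open>Needed because the extension built inside M is exchanged for a copy on another type,
  whose generators are the ones counted in \<open>Ext1_mu\<close>.\<close>

lemma min_gens_iso:
  assumes X: "module R X" and Y: "module R Y" and h: "h \<in> module_homs R X Y"
    and bij: "bij_betw h (carrier X) (carrier Y)"
  shows "min_gens R X = min_gens R Y"
proof -
  interpret X: module R X by fact
  have inj: "inj_on h (carrier X)" and im: "h ` carrier X = carrier Y"
    using bij by (auto simp: bij_betw_def)
  have "(\<exists>S. finite S \<and> card S = n \<and> S \<subseteq> carrier X \<and> mod_span R X S = carrier X)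
    \<longleftrightarrow> (\<exists>S. finite S \<and> card S = n \<and> S \<subseteq> carrier Y \<and> mod_span R Y S = carrier Y)" for n
  proof
    assume "\<exists>S. finite S \<and> card S = n \<and> S \<subseteq> carrier X \<and> mod_span R X S = carrier X"
    then obtain S where S: "finite S" "card S = n" "S \<subseteq> carrier X" "mod_span R X S = carrier X" by blast
    then show "\<exists>S. finite S \<and> card S = n \<and> S \<subseteq> carrier Y \<and> mod_span R Y S = carrier Y"
      using im inj mod_span_image[OF X Y h S(3)]
      by (intro exI[of _ "h ` S"]) (auto simp: card_image inj_on_subset)
  next
    assume "\<exists>S. finite S \<and> card S = n \<and> S \<subseteq> carrier Y \<and> mod_span R Y S = carrier Y"
    then obtain T where T: "finite T" "card T = n" "T \<subseteq> carrier Y" "mod_span R Y T = carrier Y" by blast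
    then obtain S where S: "S \<subseteq> carrier X" "T = h ` S" using im by (metis subset_imageE)
    have inj': "inj_on h S" using inj S(1) by (rule inj_on_subset)
    have "h ` mod_span R X S = h ` carrier X"
      using T(4) im mod_span_image[OF X Y h S(1)] S(2) by simp
    then have "mod_span R X S = carrier X"
      using inj X.mod_span_closed[OF S(1)] by (simp add: inj_on_image_eq_iff)
    then show "\<exists>S. finite S \<and> card S = n \<and> S \<subseteq> carrier X \<and> mod_span R X S = carrier X"
      using S T inj' by (intro exI[of _ S]) (auto simp: card_image finite_image_iff)
  qed
  then show ?thesis by (simp add: min_gens_def)
qed

section \<open>Adjoining one element x with m x in mN\<close>

context module
begin

text \<open>The annihilator of the class of x in M/N contains m and no unit, as x is not in N. This
  is why (N + R x)/N is the residue field.\<close>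

lemma smult_mem_maximal_iff:
  assumes "noetherian_local_ring R \<mm>" "submodule N R M" "x \<in> carrier M" "x \<notin> N"
    and "\<And>a. a \<in> \<mm> \<Longrightarrow> a \<odot>\<^bsub>M\<^esub> x \<in> N" and a: "a \<in> carrier R"
  shows "a \<odot>\<^bsub>M\<^esub> x \<in> N \<longleftrightarrow> a \<in> \<mm>"
proof
  interpret loc: noetherian_local_ring R \<mm> by fact
  assume ax: "a \<odot>\<^bsub>M\<^esub> x \<in> N"
  show "a \<in> \<mm>"
  proof (rule ccontr)
    assume "a \<notin> \<mm>"
    then have u: "a \<in> Units R" using a loc.non_maximal_Units by blast
    have "inv a \<odot>\<^bsub>M\<^esub> (a \<odot>\<^bsub>M\<^esub> x) = x"
      using u a assms(3) by (simp flip: smult_assoc1)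
    then show False using submoduleE(4)[OF assms(2) R.Units_inv_closed[OF u] ax] assms(4) by simp
  qed
qed (rule assms(5))

text \<open>Adjoining x to generators of N gives the upper bound. The lower bound could fail if m x
  were only contained in N: for N = m and x = 1 in a discrete valuation ring, both N and X need one
  generator.\<close>

lemma min_gens_extend:
  assumes loc: "noetherian_local_ring R \<mm>" and N: "submodule N R M"
    and fg: "fin_gen_module R (M\<lparr>carrier := N\<rparr>)"
    and x: "x \<in> carrier M" "x \<notin> N"
    and mx: "\<And>a. a \<in> \<mm> \<Longrightarrow> a \<odot>\<^bsub>M\<^esub> x \<in> ideal_smult R M \<mm> N"
    and X: "X = multiples (carrier R) x <+>\<^bsub>M\<^esub> N"
  shows "min_gens R (M\<lparr>carrier := X\<rparr>) = Suc (min_gens R (M\<lparr>carrier := N\<rparr>))"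
proof -
  interpret loc: noetherian_local_ring R \<mm> by fact
  note Nc = subsetD[OF submoduleE(1)[OF N]]
  have mN: "submodule (ideal_smult R M \<mm> N) R M"
    using Nc loc.a_subset by (intro ideal_smult_submodule) auto
  have mNN: "ideal_smult R M \<mm> N \<subseteq> N"
    using loc.a_Hcarr submoduleE(4)[OF N] by (intro ideal_smult_minimal N) auto
  have mem_iff: "a \<odot>\<^bsub>M\<^esub> x \<in> N \<longleftrightarrow> a \<in> \<mm>" if "a \<in> carrier R" for a
    using mx mNN that by (intro smult_mem_maximal_iff[OF loc N x]) auto
  have Xs: "submodule X R M"
    unfolding X by (intro submodule_sum multiples_submodule R.oneideal x N)
  note Xc = subsetD[OF submoduleE(1)[OF Xs]]
  have "x = \<one> \<odot>\<^bsub>M\<^esub> x \<oplus>\<^bsub>M\<^esub> \<zero>\<^bsub>M\<^esub>" using x by simp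
  then have xX: "x \<in> X"
    unfolding X set_add_def' multiples_def using submodule_zero[OF N] by blast
  obtain G where G: "finite G" "card G = min_gens R (M\<lparr>carrier := N\<rparr>)" "G \<subseteq> N" "mod_span R M G = N"
    using fg by (rule min_gens_witness) (use mod_span_restrict[OF N] in simp)
  have Gc: "G \<subseteq> carrier M" using G(3) Nc by auto
  have span: "mod_span R M (insert x G) = X"
    unfolding X using mod_span_insert[OF x(1) Gc] G(4) by simp
  then have GX: "insert x G \<subseteq> X" using mod_span_superset[of "insert x G"] by simp
  have le: "min_gens R (M\<lparr>carrier := X\<rparr>) \<le> Suc (card G)"
    using min_gens_le[of "insert x G" "M\<lparr>carrier := X\<rparr>" R] G(1,3) x(2) GX span mod_span_restrict[OF Xs GX]
    by (auto simp: card_insert_if split: if_splits)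
  have "fin_gen_module R (M\<lparr>carrier := X\<rparr>)"
    using G(1) GX span mod_span_restrict[OF Xs GX]
    by (auto simp: fin_gen_module_def intro!: exI[of _ "insert x G"])
  then obtain S where S: "finite S" "card S = min_gens R (M\<lparr>carrier := X\<rparr>)" "S \<subseteq> X" "mod_span R M S = X"
    by (rule min_gens_witness) (use mod_span_restrict[OF Xs] in simp)
  \<comment> \<open>Each generator of X gets an x-coordinate \<open>\<rho> s\<close>. It is
    determined only modulo m, and any choice will do.\<close>
  have "\<exists>r. r \<in> carrier R \<and> s \<ominus>\<^bsub>M\<^esub> r \<odot>\<^bsub>M\<^esub> x \<in> N" if "s \<in> S" for s
  proof -
    obtain r n where rn: "r \<in> carrier R" "n \<in> N" "s = r \<odot>\<^bsub>M\<^esub> x \<oplus>\<^bsub>M\<^esub> n"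
      using \<open>s \<in> S\<close> S(3) unfolding X by (auto simp: set_add_def' multiples_def)
    then have "s \<ominus>\<^bsub>M\<^esub> r \<odot>\<^bsub>M\<^esub> x = n"
      using x(1) Nc by (simp add: M.minus_eq M.a_ac M.r_neg)
    then show ?thesis using rn by blast
  qed
  then obtain \<rho> where \<rho>: "\<And>s. s \<in> S \<Longrightarrow> \<rho> s \<in> carrier R" "\<And>s. s \<in> S \<Longrightarrow> s \<ominus>\<^bsub>M\<^esub> \<rho> s \<odot>\<^bsub>M\<^esub> x \<in> N"
    by metis
  \<comment> \<open>If all x-coordinates were in m, then S and with it X would lie in N, against the
    choice of x.\<close>
  have "\<exists>s\<in>S. \<rho> s \<notin> \<mm>"
  proof (rule ccontr)
    assume neg: "\<not> (\<exists>s\<in>S. \<rho> s \<notin> \<mm>)"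
    have "S \<subseteq> N"
    proof
      fix s assume s: "s \<in> S"
      have "s = (s \<ominus>\<^bsub>M\<^esub> \<rho> s \<odot>\<^bsub>M\<^esub> x) \<oplus>\<^bsub>M\<^esub> \<rho> s \<odot>\<^bsub>M\<^esub> x"
        using s S(3) Xc \<rho>(1) x(1) by (auto simp: M.minus_eq M.a_assoc M.l_neg)
      moreover have "\<rho> s \<odot>\<^bsub>M\<^esub> x \<in> N" using neg s \<rho>(1) mem_iff by auto
      ultimately show "s \<in> N" using submoduleE(5)[OF N \<rho>(2)[OF s]] by metis
    qed
    then have "X \<subseteq> N" using mod_span_minimal[OF N] S(4) by auto
    then show False using xX x(2) by auto
  qed
  then obtain s1 where s1: "s1 \<in> S" "\<rho> s1 \<notin> \<mm>" by blast
  have s1c: "s1 \<in> carrier M" using s1 S(3) Xc by auto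
  have u: "\<rho> s1 \<in> Units R" using s1 \<rho>(1) loc.non_maximal_Units by blast
  \<comment> \<open>Subtracting multiples of \<open>s1\<close>, whose \<open>x\<close>-coordinate is a unit, moves the other generators
    of \<open>X\<close> into \<open>N\<close>. They generate \<open>N\<close> modulo \<open>\<mm> N\<close>: a multiple \<open>a s1\<close> lies in \<open>N\<close> only if
    \<open>a \<in> \<mm>\<close>, and then \<open>a s1 \<in> \<mm> N + R (a x) \<subseteq> \<mm> N\<close>.\<close>
  define c where "c s = \<rho> s \<otimes> inv (\<rho> s1)" for s
  have c: "c s \<in> carrier R" if "s \<in> S" for s using that \<rho>(1) u by (simp add: c_def)
  define T where "T = (\<lambda>s. s \<ominus>\<^bsub>M\<^esub> c s \<odot>\<^bsub>M\<^esub> s1) ` (S - {s1})"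
  have TN: "T \<subseteq> N"
  proof
    fix t assume "t \<in> T"
    then obtain s where s: "s \<in> S" "t = s \<ominus>\<^bsub>M\<^esub> c s \<odot>\<^bsub>M\<^esub> s1" by (auto simp: T_def)
    have sc: "s \<in> carrier M" using s S(3) Xc by auto
    \<comment> \<open>The factor \<open>c s\<close> makes the x-coordinates of s and of its multiple
      of \<open>s1\<close> cancel, which leaves a combination of their parts in N.\<close>
    have "c s \<otimes> \<rho> s1 = \<rho> s"
      using u s(1) \<rho>(1) by (simp add: c_def R.m_assoc R.Units_closed)
    then have "c s \<odot>\<^bsub>M\<^esub> (\<rho> s1 \<odot>\<^bsub>M\<^esub> x) = \<rho> s \<odot>\<^bsub>M\<^esub> x"
      using smult_assoc1[OF c[OF s(1)] \<rho>(1)[OF s1(1)] x(1)] by simp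
    then have "t = (s \<ominus>\<^bsub>M\<^esub> \<rho> s \<odot>\<^bsub>M\<^esub> x) \<ominus>\<^bsub>M\<^esub> c s \<odot>\<^bsub>M\<^esub> (s1 \<ominus>\<^bsub>M\<^esub> \<rho> s1 \<odot>\<^bsub>M\<^esub> x)"
      using s(2) c[OF s(1)] sc s1c x(1) \<rho>(1)[OF s(1)] \<rho>(1)[OF s1(1)]
      by (simp add: M.minus_eq smult_r_distr smult_r_minus M.minus_add M.a_ac M.r_neg M.r_neg1 M.r_neg2)
    then show "t \<in> N"
      using submodule_minus[OF N \<rho>(2)[OF s(1)] submoduleE(4)[OF N c[OF s(1)] \<rho>(2)[OF s1(1)]]] by simp
  qed
  have Tc: "T \<subseteq> carrier M" using TN Nc by auto
  have L: "submodule (mod_span R M T) R M" by (rule mod_span_submodule[OF Tc])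
  have LN: "mod_span R M T \<subseteq> N" using TN by (rule mod_span_minimal[OF N])
  have "X \<subseteq> multiples (carrier R) s1 <+>\<^bsub>M\<^esub> mod_span R M T"
  proof -
    have "s \<in> mod_span R M (insert s1 T)" if s: "s \<in> S" for s
    proof (cases "s = s1")
      case True
      then show ?thesis using mod_span_superset[of "insert s1 T"] by auto
    next
      case False
      have sub: "submodule (mod_span R M (insert s1 T)) R M"
        using Tc s1c by (intro mod_span_submodule) auto
      have m: "s1 \<in> mod_span R M (insert s1 T)" "s \<ominus>\<^bsub>M\<^esub> c s \<odot>\<^bsub>M\<^esub> s1 \<in> mod_span R M (insert s1 T)"
        using mod_span_superset[of "insert s1 T"] s False by (auto simp: T_def)
      have "s = (s \<ominus>\<^bsub>M\<^esub> c s \<odot>\<^bsub>M\<^esub> s1) \<oplus>\<^bsub>M\<^esub> c s \<odot>\<^bsub>M\<^esub> s1"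
        using s S(3) Xc c s1c by (auto simp: M.minus_eq M.a_assoc M.l_neg)
      then show ?thesis
        using submoduleE(5)[OF sub m(2) submoduleE(4)[OF sub c[OF s] m(1)]] by simp
    qed
    then have "mod_span R M S \<subseteq> mod_span R M (insert s1 T)"
      using Tc s1c by (intro mod_span_minimal mod_span_submodule) auto
    then show ?thesis using S(4) mod_span_insert[OF s1c Tc] by simp
  qed
  moreover have "N \<subseteq> X"
  proof
    fix n assume n: "n \<in> N"
    then have "n = \<zero> \<odot>\<^bsub>M\<^esub> x \<oplus>\<^bsub>M\<^esub> n" using x Nc by simp
    then show "n \<in> X" unfolding X set_add_def' multiples_def using n by blast
  qed
  ultimately have NX: "N \<subseteq> multiples (carrier R) s1 <+>\<^bsub>M\<^esub> mod_span R M T" by blast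
  have "N \<subseteq> mod_span R M T <+>\<^bsub>M\<^esub> ideal_smult R M \<mm> N"
  proof
    fix n assume n: "n \<in> N"
    then obtain a t where a: "a \<in> carrier R" "t \<in> mod_span R M T" "n = a \<odot>\<^bsub>M\<^esub> s1 \<oplus>\<^bsub>M\<^esub> t"
      using NX by (auto simp: set_add_def' multiples_def)
    have tc: "t \<in> N" "t \<in> carrier M" using a(2) LN Nc by auto
    let ?y = "s1 \<ominus>\<^bsub>M\<^esub> \<rho> s1 \<odot>\<^bsub>M\<^esub> x"
    note y = \<rho>(2)[OF s1(1)]
    have "a \<odot>\<^bsub>M\<^esub> s1 = n \<ominus>\<^bsub>M\<^esub> t"
      using a(1,3) tc s1c by (simp add: M.minus_eq M.a_assoc M.r_neg)
    then have "a \<odot>\<^bsub>M\<^esub> s1 \<in> N" using submodule_minus[OF N n tc(1)] by simp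
    moreover have "a \<odot>\<^bsub>M\<^esub> ?y \<in> N" using submoduleE(4)[OF N a(1) y] .
    ultimately have "a \<odot>\<^bsub>M\<^esub> s1 \<ominus>\<^bsub>M\<^esub> a \<odot>\<^bsub>M\<^esub> ?y \<in> N" by (rule submodule_minus[OF N])
    \<comment> \<open>This decomposition is read twice: first in N, where it forces a into m because
      \<open>\<rho> s1\<close> is a unit, and then in mN, where both summands now lie.\<close>
    moreover have split: "a \<odot>\<^bsub>M\<^esub> s1 = a \<odot>\<^bsub>M\<^esub> ?y \<oplus>\<^bsub>M\<^esub> \<rho> s1 \<odot>\<^bsub>M\<^esub> (a \<odot>\<^bsub>M\<^esub> x)"
      using a(1) s1c x(1) \<rho>(1)[OF s1(1)] R.m_comm[OF a(1) \<rho>(1)[OF s1(1)]]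
      by (simp add: M.minus_eq smult_r_distr smult_r_minus M.a_assoc M.l_neg flip: smult_assoc1)
    ultimately have "\<rho> s1 \<odot>\<^bsub>M\<^esub> (a \<odot>\<^bsub>M\<^esub> x) \<in> N"
      using a(1) s1c x(1) \<rho>(1)[OF s1(1)] Nc[OF y] by (simp add: M.minus_eq M.a_ac M.r_neg)
    then have "(\<rho> s1 \<otimes> a) \<odot>\<^bsub>M\<^esub> x \<in> N"
      using a(1) \<rho>(1)[OF s1(1)] x(1) by (simp add: smult_assoc1)
    then have "\<rho> s1 \<otimes> a \<in> \<mm>" using mem_iff a(1) \<rho>(1)[OF s1(1)] by auto
    then have "inv (\<rho> s1) \<otimes> (\<rho> s1 \<otimes> a) \<in> \<mm>" by (rule loc.I_l_closed[OF _ R.Units_inv_closed[OF u]])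
    then have am: "a \<in> \<mm>" using u a(1) by (simp add: R.Units_closed flip: R.m_assoc)
    have "\<rho> s1 \<odot>\<^bsub>M\<^esub> (a \<odot>\<^bsub>M\<^esub> x) \<in> ideal_smult R M \<mm> N"
      using submoduleE(4)[OF mN \<rho>(1)[OF s1(1)] mx[OF am]] .
    moreover have "a \<odot>\<^bsub>M\<^esub> ?y \<in> ideal_smult R M \<mm> N" using am y by (rule ideal_smult_mem)
    ultimately have "a \<odot>\<^bsub>M\<^esub> s1 \<in> ideal_smult R M \<mm> N"
      using submoduleE(5)[OF mN] split by simp
    moreover have "n = t \<oplus>\<^bsub>M\<^esub> a \<odot>\<^bsub>M\<^esub> s1" using a(1,3) tc s1c by (simp add: M.a_comm)
    ultimately show "n \<in> mod_span R M T <+>\<^bsub>M\<^esub> ideal_smult R M \<mm> N"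
      using a(2) by (auto simp: set_add_def')
  qed
  \<comment> \<open>Nakayama's lemma wants N presented as the span of a submodule and a finite set;
    the original generators \<open>G\<close> serve as that set.\<close>
  moreover have eqN: "mod_span R M (mod_span R M T \<union> G) = N"
  proof
    show "mod_span R M (mod_span R M T \<union> G) \<subseteq> N"
      using LN G(3) by (intro mod_span_minimal N) auto
    show "N \<subseteq> mod_span R M (mod_span R M T \<union> G)"
      using G(4) mod_span_mono[of G "mod_span R M T \<union> G"] by auto
  qed
  ultimately have "mod_span R M (mod_span R M T \<union> G) = mod_span R M T"
    by (intro nakayama[OF loc module_axioms G(1) Gc L]) simp
  then have "mod_span R M T = N" using eqN by simp
  then have "min_gens R (M\<lparr>carrier := N\<rparr>) \<le> card T"
    using min_gens_le[of T "M\<lparr>carrier := N\<rparr>" R] S(1) TN mod_span_restrict[OF N TN] by (simp add: T_def)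
  \<comment> \<open>Distinct generators may have the same image in \<open>T\<close>, but an
    inequality suffices; the strict drop comes from the removal of \<open>s1\<close>.\<close>
  also have "\<dots> \<le> card (S - {s1})" unfolding T_def using S(1) by (intro card_image_le) auto
  also have "\<dots> < card S" using S(1) s1(1) by (rule card_Diff1_less)
  finally show ?thesis using le S(2) G(2) by simp
qed

end

section \<open>Extensions of the residue field\<close>

text \<open>The middle term of an extension has the plain record type \<open>module\<close>, while M
  may carry further fields; truncation discards exactly those.\<close>

lemma module_truncate: "module R M \<Longrightarrow> module R (module.truncate M)"
proof -
  assume "module R M"
  then interpret module R M .
  have "abelian_group (module.truncate M)"
    by (rule abelian_groupI) (auto simp: module.defs M.a_ac intro: M.l_neg)
  then show ?thesis
    by (intro moduleI R.cring_axioms)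
       (auto simp: module.defs smult_l_distr smult_r_distr smult_assoc1)
qed

lemma min_gens_truncate:
  assumes "module R M"
  shows "min_gens R (module.truncate M) = min_gens R M"
proof -
  interpret module R M by fact
  have "(\<lambda>x. x) \<in> module_homs R M (module.truncate M)"
    by (auto simp: module_homs_def module.defs)
  moreover have "bij_betw (\<lambda>x. x) (carrier M) (carrier (module.truncate M))"
    by (auto simp: bij_betw_def module.defs)
  ultimately show ?thesis
    using min_gens_iso[OF assms module_truncate[OF assms]] by metis
qed

text \<open>The residue field is formed as a quotient of the ring viewed as a module over itself;
  these equations make the coset theory of ideals available for it.\<close>

lemma residue_module_simps:
  "carrier (residue_module R \<mm>) = a_rcosets\<^bsub>R\<^esub> \<mm>"
  "\<zero>\<^bsub>residue_module R \<mm>\<^esub> = \<mm>"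
  "add (residue_module R \<mm>) = set_add R"
  "r \<odot>\<^bsub>residue_module R \<mm>\<^esub> C = (\<Union>x\<in>C. \<mm> +>\<^bsub>R\<^esub> (r \<otimes>\<^bsub>R\<^esub> x))"
  by (auto simp: residue_module_def quot_module_def regular_module_def A_RCOSETS_defs
      a_r_coset_defs set_add_def set_mult_def fun_eq_iff)

lemma (in cring) residue_module_smult:
  assumes "ideal \<mm> R" "r \<in> carrier R" "y \<in> carrier R"
  shows "r \<odot>\<^bsub>residue_module R \<mm>\<^esub> (\<mm> +> y) = \<mm> +> (r \<otimes> y)"
proof -
  interpret \<mm>: ideal \<mm> R by fact
  have "\<mm> +> (r \<otimes> x) = \<mm> +> (r \<otimes> y)" if "x \<in> \<mm> +> y" for x
  proof -
    obtain h where h: "h \<in> \<mm>" "x = h \<oplus> y" using \<open>x \<in> _\<close> by (auto simp: a_r_coset_def')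
    have "r \<otimes> h \<in> \<mm>" using \<mm>.I_l_closed[OF h(1) assms(2)] .
    moreover have "r \<otimes> x = r \<otimes> h \<oplus> r \<otimes> y"
      using h assms(2,3) \<mm>.a_Hcarr by (simp add: r_distr)
    ultimately have "r \<otimes> x \<in> \<mm> +> (r \<otimes> y)" by (auto simp: a_r_coset_def')
    then show ?thesis
      using a_repr_independence[of "r \<otimes> x" \<mm> "r \<otimes> y"] assms(2,3) \<mm>.a_subgroup by auto
  qed
  moreover have "y \<in> \<mm> +> y" using assms(3) \<mm>.zero_closed by (force simp: a_r_coset_def')
  ultimately show ?thesis unfolding residue_module_simps by blast
qed

text \<open>The class of 1 generates, and it is nonzero, so the empty set does not.\<close>

lemma (in noetherian_local_ring) min_gens_residue_module: "min_gens R (residue_module R \<mm>) = 1"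
proof -
  let ?K = "residue_module R \<mm>"
  have "module R ?K" by (intro residue_module_module is_cring is_ideal)
  then interpret K: module R ?K .
  have K: "carrier ?K = (\<lambda>r. \<mm> +> r) ` carrier R"
    by (auto simp: residue_module_simps A_RCOSETS_def')
  have one: "\<mm> +> \<one> \<in> carrier ?K" using K by auto
  have sub: "submodule (mod_span R ?K {\<mm> +> \<one>}) R ?K"
    using one by (intro K.mod_span_submodule) auto
  have "\<mm> +> r \<in> mod_span R ?K {\<mm> +> \<one>}" if "r \<in> carrier R" for r
    using K.submoduleE(4)[OF sub that, of "\<mm> +> \<one>"] K.mod_span_superset[of "{\<mm> +> \<one>}"] that
    by (simp add: residue_module_smult[OF is_ideal])
  then have span: "mod_span R ?K {\<mm> +> \<one>} = carrier ?K"
    using K.mod_span_closed[of "{\<mm> +> \<one>}"] one K by auto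
  have le: "min_gens R ?K \<le> 1"
    using min_gens_le[of "{\<mm> +> \<one>}" ?K R] one span by auto
  have "fin_gen_module R ?K"
    using one span by (auto simp: fin_gen_module_def intro!: exI[of _ "{\<mm> +> \<one>}"])
  then obtain S where S: "finite S" "card S = min_gens R ?K" "mod_span R ?K S = carrier ?K"
    by (rule min_gens_witness)
  have "min_gens R ?K \<noteq> 0"
  proof
    assume "min_gens R ?K = 0"
    then have "S = {}" using S by simp
    then have "\<mm> +> \<one> = \<mm>"
      using S(3) one K.mod_span_empty by (auto simp: residue_module_simps)
    moreover have "\<one> \<in> \<mm> +> \<one>" using zero_closed by (force simp: a_r_coset_def')
    ultimately show False using one_notin_maximal by simp
  qed
  then show ?thesis using le by simp
qed

context module
begin

text \<open>The projection sends \<open>n + r x\<close> to the coset \<open>\<mm> + r\<close>; the set comprehension describes this coset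
  without choosing \<open>r\<close>.\<close>

lemma residue_extension:
  assumes loc: "noetherian_local_ring R \<mm>" and N: "submodule N R M"
    and x: "x \<in> carrier M" "x \<notin> N" and mx: "\<And>a. a \<in> \<mm> \<Longrightarrow> a \<odot>\<^bsub>M\<^esub> x \<in> N"
    and X: "X = multiples (carrier R) x <+>\<^bsub>M\<^esub> N"
  shows "(module.truncate (M\<lparr>carrier := X\<rparr>), \<lambda>n. n, \<lambda>y. {r \<in> carrier R. y \<ominus>\<^bsub>M\<^esub> r \<odot>\<^bsub>M\<^esub> x \<in> N})
    \<in> short_exact_sequences R (residue_module R \<mm>) (M\<lparr>carrier := N\<rparr>)"
proof -
  interpret loc: noetherian_local_ring R \<mm> by fact
  define p where "p y = {r \<in> carrier R. y \<ominus>\<^bsub>M\<^esub> r \<odot>\<^bsub>M\<^esub> x \<in> N}" for y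
  note Nc = subsetD[OF submoduleE(1)[OF N]]
  have Xs: "submodule X R M"
    unfolding X by (intro submodule_sum multiples_submodule R.oneideal x N)
  note Xc = subsetD[OF submoduleE(1)[OF Xs]]
  have K: "carrier (residue_module R \<mm>) = (\<lambda>r. \<mm> +> r) ` carrier R"
    by (auto simp: residue_module_simps A_RCOSETS_def')
  \<comment> \<open>Two coordinates of y differ by an element that multiplies x into N, that is, by
    an element of m. Hence any one coordinate determines \<open>p y\<close>, and compatibility of p
    with the operations reduces to exhibiting a coordinate of the result.\<close>
  have p_eq: "p y = \<mm> +> r" if y: "y \<in> X" and r: "r \<in> carrier R" "y \<ominus>\<^bsub>M\<^esub> r \<odot>\<^bsub>M\<^esub> x \<in> N" for y r
  proof -
    have "y \<ominus>\<^bsub>M\<^esub> r' \<odot>\<^bsub>M\<^esub> x \<in> N \<longleftrightarrow> r' \<ominus> r \<in> \<mm>" if r': "r' \<in> carrier R" for r'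
    proof -
      have eq: "(r' \<ominus> r) \<odot>\<^bsub>M\<^esub> x = (y \<ominus>\<^bsub>M\<^esub> r \<odot>\<^bsub>M\<^esub> x) \<ominus>\<^bsub>M\<^esub> (y \<ominus>\<^bsub>M\<^esub> r' \<odot>\<^bsub>M\<^esub> x)"
        "y \<ominus>\<^bsub>M\<^esub> r' \<odot>\<^bsub>M\<^esub> x = (y \<ominus>\<^bsub>M\<^esub> r \<odot>\<^bsub>M\<^esub> x) \<ominus>\<^bsub>M\<^esub> (r' \<ominus> r) \<odot>\<^bsub>M\<^esub> x"
        using Xc[OF y] r(1) r' x(1)
          M.a_lcomm[of "r \<odot>\<^bsub>M\<^esub> x" "\<ominus>\<^bsub>M\<^esub> (r' \<odot>\<^bsub>M\<^esub> x)" "\<ominus>\<^bsub>M\<^esub> (r \<odot>\<^bsub>M\<^esub> x)"]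
        by (simp_all add: M.minus_eq R.minus_eq smult_l_distr smult_l_minus M.minus_add M.a_ac
            M.r_neg M.r_neg1 M.r_neg2)
      have "y \<ominus>\<^bsub>M\<^esub> r' \<odot>\<^bsub>M\<^esub> x \<in> N \<longleftrightarrow> (r' \<ominus> r) \<odot>\<^bsub>M\<^esub> x \<in> N"
        using submodule_minus[OF N r(2)] eq by metis
      then show ?thesis
        using smult_mem_maximal_iff[OF loc N x mx, of "r' \<ominus> r"] r(1) r' by simp
    qed
    moreover have "r' \<ominus> r \<in> \<mm> \<longleftrightarrow> r' \<in> \<mm> +> r" if r': "r' \<in> carrier R" for r'
    proof
      assume "r' \<ominus> r \<in> \<mm>"
      moreover have "r' = (r' \<ominus> r) \<oplus> r" using r(1) r' by (simp add: R.minus_eq R.a_assoc R.l_neg)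
      ultimately show "r' \<in> \<mm> +> r" unfolding a_r_coset_def' by blast
    next
      assume "r' \<in> \<mm> +> r"
      then obtain h where "h \<in> \<mm>" "r' = h \<oplus> r" by (auto simp: a_r_coset_def')
      then show "r' \<ominus> r \<in> \<mm>"
        using r(1) loc.a_Hcarr by (simp add: R.minus_eq R.a_assoc R.r_neg)
    qed
    moreover have "\<mm> +> r \<subseteq> carrier R" using r(1) loc.a_subset by (rule R.a_r_coset_subset_G[rotated])
    ultimately show ?thesis unfolding p_def by blast
  qed
  have rep: "\<exists>r. r \<in> carrier R \<and> y \<ominus>\<^bsub>M\<^esub> r \<odot>\<^bsub>M\<^esub> x \<in> N" if "y \<in> X" for y
  proof -
    obtain r n where rn: "r \<in> carrier R" "n \<in> N" "y = r \<odot>\<^bsub>M\<^esub> x \<oplus>\<^bsub>M\<^esub> n"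
      using \<open>y \<in> X\<close> unfolding X by (auto simp: set_add_def' multiples_def)
    then have "y \<ominus>\<^bsub>M\<^esub> r \<odot>\<^bsub>M\<^esub> x = n"
      using x(1) Nc by (simp add: M.minus_eq M.a_ac M.r_neg)
    then show ?thesis using rn by blast
  qed
  have mX: "r \<odot>\<^bsub>M\<^esub> x \<oplus>\<^bsub>M\<^esub> n \<in> X" if "r \<in> carrier R" "n \<in> N" for r n
    unfolding X using that by (intro mem_set_addI) (auto simp: multiples_def)
  have NX: "N \<subseteq> X"
  proof
    fix n assume "n \<in> N"
    then show "n \<in> X" using mX[of \<zero> n] x(1) Nc by simp
  qed
  have p_K: "p y \<in> carrier (residue_module R \<mm>)" if "y \<in> X" for y
    using rep[OF that] p_eq[OF that] K by auto
  have p_add: "p (y \<oplus>\<^bsub>M\<^esub> z) = p y <+> p z" if y: "y \<in> X" and z: "z \<in> X" for y z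
  proof -
    obtain r s where rs: "r \<in> carrier R" "y \<ominus>\<^bsub>M\<^esub> r \<odot>\<^bsub>M\<^esub> x \<in> N" "s \<in> carrier R" "z \<ominus>\<^bsub>M\<^esub> s \<odot>\<^bsub>M\<^esub> x \<in> N"
      using rep[OF y] rep[OF z] by blast
    have "(y \<oplus>\<^bsub>M\<^esub> z) \<ominus>\<^bsub>M\<^esub> (r \<oplus> s) \<odot>\<^bsub>M\<^esub> x = (y \<ominus>\<^bsub>M\<^esub> r \<odot>\<^bsub>M\<^esub> x) \<oplus>\<^bsub>M\<^esub> (z \<ominus>\<^bsub>M\<^esub> s \<odot>\<^bsub>M\<^esub> x)"
      using Xc[OF y] Xc[OF z] rs(1,3) x(1) by (simp add: M.minus_eq smult_l_distr M.minus_add M.a_ac)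
    then have "(y \<oplus>\<^bsub>M\<^esub> z) \<ominus>\<^bsub>M\<^esub> (r \<oplus> s) \<odot>\<^bsub>M\<^esub> x \<in> N"
      using submoduleE(5)[OF N rs(2,4)] by simp
    then have "p (y \<oplus>\<^bsub>M\<^esub> z) = \<mm> +> (r \<oplus> s)"
      using rs submoduleE(5)[OF Xs y z] by (intro p_eq) auto
    then show ?thesis using p_eq[OF y rs(1,2)] p_eq[OF z rs(3,4)] loc.a_rcos_sum rs by simp
  qed
  have p_smult: "p (a \<odot>\<^bsub>M\<^esub> y) = a \<odot>\<^bsub>residue_module R \<mm>\<^esub> p y" if a: "a \<in> carrier R" and y: "y \<in> X" for a y
  proof -
    obtain r where r: "r \<in> carrier R" "y \<ominus>\<^bsub>M\<^esub> r \<odot>\<^bsub>M\<^esub> x \<in> N"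
      using rep[OF y] by blast
    have "(a \<odot>\<^bsub>M\<^esub> y) \<ominus>\<^bsub>M\<^esub> (a \<otimes> r) \<odot>\<^bsub>M\<^esub> x = a \<odot>\<^bsub>M\<^esub> (y \<ominus>\<^bsub>M\<^esub> r \<odot>\<^bsub>M\<^esub> x)"
      using Xc[OF y] a r(1) x(1) by (simp add: M.minus_eq smult_r_distr smult_r_minus smult_assoc1)
    then have "(a \<odot>\<^bsub>M\<^esub> y) \<ominus>\<^bsub>M\<^esub> (a \<otimes> r) \<odot>\<^bsub>M\<^esub> x \<in> N"
      using submoduleE(4)[OF N a r(2)] by simp
    then have "p (a \<odot>\<^bsub>M\<^esub> y) = \<mm> +> (a \<otimes> r)"
      using a r submoduleE(4)[OF Xs a y] by (intro p_eq) auto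
    then show ?thesis
      using p_eq[OF y r] R.residue_module_smult[OF loc.is_ideal a r(1)] by simp
  qed
  have ker: "{y \<in> X. p y = \<mm>} = N"
  proof (intro equalityI subsetI)
    fix n assume n: "n \<in> N"
    then have "p n = \<mm> +> \<zero>" using NX Nc x(1) by (intro p_eq) (auto simp: M.minus_eq M.a_inv_zero)
    then show "n \<in> {y \<in> X. p y = \<mm>}" using n NX loc.a_subset by (auto simp: R.a_coset_add_zero)
  next
    fix y assume y: "y \<in> {y \<in> X. p y = \<mm>}"
    \<comment> \<open>The zero of the residue field is the set \<open>\<mm>\<close>, which contains
      0; that 0 is a coordinate of y means y lies in N.\<close>
    then have "\<zero> \<in> p y" by simp
    then show "y \<in> N" using y Xc x(1) by (auto simp: p_def M.minus_eq M.a_inv_zero)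
  qed
  have surj: "p ` X = carrier (residue_module R \<mm>)"
  proof (intro equalityI subsetI)
    fix C assume "C \<in> carrier (residue_module R \<mm>)"
    then obtain r where r: "r \<in> carrier R" "C = \<mm> +> r" using K by auto
    have "p (r \<odot>\<^bsub>M\<^esub> x) = C"
      unfolding r(2) using r(1) x(1) mX[OF r(1) submodule_zero[OF N]] submodule_zero[OF N]
      by (intro p_eq) (auto simp: M.minus_eq M.r_neg)
    moreover have "r \<odot>\<^bsub>M\<^esub> x \<in> X" using mX[OF r(1) submodule_zero[OF N]] r(1) x(1) by simp
    ultimately show "C \<in> p ` X" by blast
  qed (use p_K in auto)
  let ?E = "module.truncate (M\<lparr>carrier := X\<rparr>)" and ?N = "M\<lparr>carrier := N\<rparr>" and ?K = "residue_module R \<mm>"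
  have E: "carrier ?E = X" "add ?E = add M" "smult ?E = smult M" by (simp_all add: module.defs)
  have "module R ?E"
    using submodule.submodule_is_module[OF Xs module_axioms] by (rule module_truncate)
  moreover have "(\<lambda>n. n) \<in> module_homs R ?N ?E"
    using NX by (simp add: module_homs_def E subset_iff)
  moreover have "p \<in> module_homs R ?E ?K"
    using p_K p_add p_smult by (simp add: module_homs_def E residue_module_simps(3))
  moreover have "(\<lambda>n. n) ` carrier ?N = a_kernel ?E ?K p"
    using ker by (simp add: a_kernel_def kernel_def E residue_module_simps(2))
  ultimately show ?thesis
    using surj unfolding p_def[abs_def, symmetric] short_exact_sequences_def by (simp add: E)
qed

section \<open>Colon submodules, the socle and positive depth\<close>

lemma mod_colon_submodule:
  assumes "I \<subseteq> carrier R" "submodule L R M"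
  shows "submodule (mod_colon M L I) R M"
proof (rule submodule_smultI)
  show "a \<odot>\<^bsub>M\<^esub> x \<in> mod_colon M L I" if a: "a \<in> carrier R" and x: "x \<in> mod_colon M L I" for a x
  proof -
    have "b \<odot>\<^bsub>M\<^esub> (a \<odot>\<^bsub>M\<^esub> x) \<in> L" if b: "b \<in> I" for b
    proof -
      have "b \<odot>\<^bsub>M\<^esub> (a \<odot>\<^bsub>M\<^esub> x) = a \<odot>\<^bsub>M\<^esub> (b \<odot>\<^bsub>M\<^esub> x)"
        using a b x assms(1) R.m_comm[of a b] by (auto simp: mod_colon_def simp flip: smult_assoc1)
      then show ?thesis using a b x submoduleE(4)[OF assms(2)] by (auto simp: mod_colon_def)
    qed
    then show ?thesis using a x by (auto simp: mod_colon_def)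
  qed
qed (use assms submoduleE(5)[OF assms(2)] submodule_zero[OF assms(2)]
    in \<open>auto simp: mod_colon_def smult_r_distr subset_iff\<close>)

lemma zero_submodule: "submodule {\<zero>\<^bsub>M\<^esub>} R M"
  by (rule submodule_smultI) auto

lemma socle_submodule: "I \<subseteq> carrier R \<Longrightarrow> submodule (socle M I) R M"
  unfolding socle_def by (intro mod_colon_submodule zero_submodule)

lemma socle_eq_zero_of_depth_pos:
  assumes m: "\<mm> \<subseteq> carrier R" and depth: "0 < depth R \<mm> M"
  shows "socle M \<mm> = {\<zero>\<^bsub>M\<^esub>}"
proof (cases "carrier M = {\<zero>\<^bsub>M\<^esub>}")
  \<comment> \<open>The zero module has infinite depth by convention, so no regular sequence can be
    extracted from its depth.\<close>
  case True
  then show ?thesis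
    using submoduleE(1)[OF socle_submodule[OF m]] submodule_zero[OF socle_submodule[OF m]] by auto
next
  case False
  then have "0 < Sup {enat (length rs) | rs. set rs \<subseteq> \<mm> \<and> regular_sequence R M rs}"
    using depth by (simp add: depth_def)
  then obtain rs where "set rs \<subseteq> \<mm>" "regular_sequence R M rs" "0 < enat (length rs)"
    unfolding less_Sup_iff by blast
  then have rs: "set rs \<subseteq> \<mm>" "regular_sequence R M rs" "rs \<noteq> []"
    by (auto simp flip: zero_enat_def)
  \<comment> \<open>The first term of a regular sequence is tested on M modulo the product with the
    ideal generated by the empty set. That product is zero, so the quotient has singleton cosets and
    the term is a nonzerodivisor on M itself.\<close>
  let ?Z = "ideal_smult R M (Idl {}) (carrier M)"
  define r where "r = rs ! 0"
  have r: "r \<in> \<mm>" using rs(1,3) nth_mem[of 0 rs] by (auto simp: r_def)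
  then have rR: "r \<in> carrier R" using m by blast
  have nzd: "nonzerodivisor_on (quot_module M ?Z) r"
  proof -
    have "\<forall>i<length rs. nonzerodivisor_on
       (quot_module M (ideal_smult R M (Idl (set (take i rs))) (carrier M))) (rs ! i)"
      using rs(2) unfolding regular_sequence_def by (elim conjE)
    moreover have "0 < length rs" using rs(3) by simp
    ultimately have "nonzerodivisor_on
       (quot_module M (ideal_smult R M (Idl (set (take 0 rs))) (carrier M))) (rs ! 0)"
      by (elim allE impE)
    then show ?thesis by (simp add: r_def)
  qed
  have Idl: "Idl {} \<subseteq> {\<zero>}" by (intro R.genideal_minimal R.zeroideal) auto
  then have "?Z \<subseteq> {\<zero>\<^bsub>M\<^esub>}" by (intro ideal_smult_minimal zero_submodule) auto
  moreover have Zs: "submodule ?Z R M"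
    using Idl by (intro ideal_smult_submodule) auto
  ultimately have Z: "?Z = {\<zero>\<^bsub>M\<^esub>}" using submodule_zero[OF Zs] by blast
  have "x = \<zero>\<^bsub>M\<^esub>" if x: "x \<in> socle M \<mm>" for x
  proof -
    have xM: "x \<in> carrier M" and rx: "r \<odot>\<^bsub>M\<^esub> x = \<zero>\<^bsub>M\<^esub>"
      using x r by (auto simp: socle_def mod_colon_def)
    have "r \<odot>\<^bsub>quot_module M ?Z\<^esub> (?Z +>\<^bsub>M\<^esub> x) = ?Z +>\<^bsub>M\<^esub> \<zero>\<^bsub>M\<^esub>"
      using quot_module_smult[OF module_axioms Zs rR xM] rx by simp
    also have "\<dots> = \<zero>\<^bsub>quot_module M ?Z\<^esub>"
      unfolding Z by (simp add: quot_module_def a_r_coset_def')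
    finally have "r \<odot>\<^bsub>quot_module M ?Z\<^esub> (?Z +>\<^bsub>M\<^esub> x) = \<zero>\<^bsub>quot_module M ?Z\<^esub>" .
    moreover have "?Z +>\<^bsub>M\<^esub> x \<in> carrier (quot_module M ?Z)"
      using xM unfolding quot_module_def A_RCOSETS_def' by simp blast
    ultimately have "?Z +>\<^bsub>M\<^esub> x = \<zero>\<^bsub>quot_module M ?Z\<^esub>"
      using nzd unfolding nonzerodivisor_on_def by blast
    then show ?thesis using xM unfolding Z by (simp add: quot_module_def a_r_coset_def')
  qed
  then show ?thesis using submodule_zero[OF socle_submodule[OF m]] by blast
qed

text \<open>The ideal kills the socle. This yields the easy inclusion of the colon formula, and it
  turns that formula into weak fullness of the sum.\<close>

lemma ideal_smult_add_socle:
  assumes I: "I \<subseteq> carrier R" and N: "submodule N R M"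
  shows "ideal_smult R M I (N <+>\<^bsub>M\<^esub> socle M I) = ideal_smult R M I N"
proof
  note Nc = subsetD[OF submoduleE(1)[OF N]]
  note Ss = socle_submodule[OF I]
  have sub: "submodule (ideal_smult R M I N) R M"
    using I Nc by (intro ideal_smult_submodule) auto
  show "ideal_smult R M I (N <+>\<^bsub>M\<^esub> socle M I) \<subseteq> ideal_smult R M I N"
  proof (rule ideal_smult_minimal[OF sub])
    fix a y assume a: "a \<in> I" and "y \<in> N <+>\<^bsub>M\<^esub> socle M I"
    then obtain n s where ns: "n \<in> N" "s \<in> socle M I" "y = n \<oplus>\<^bsub>M\<^esub> s" by (auto simp: set_add_def')
    then have "a \<odot>\<^bsub>M\<^esub> y = a \<odot>\<^bsub>M\<^esub> n"
      using a I Nc by (auto simp: socle_def mod_colon_def smult_r_distr subset_iff)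
    then show "a \<odot>\<^bsub>M\<^esub> y \<in> ideal_smult R M I N" using a ns(1) by (simp add: ideal_smult_mem)
  qed
  have sum: "submodule (N <+>\<^bsub>M\<^esub> socle M I) R M" by (rule submodule_sum[OF N Ss])
  show "ideal_smult R M I N \<subseteq> ideal_smult R M I (N <+>\<^bsub>M\<^esub> socle M I)"
  proof (rule ideal_smult_minimal)
    show "submodule (ideal_smult R M I (N <+>\<^bsub>M\<^esub> socle M I)) R M"
      using I submoduleE(1)[OF sum] by (rule ideal_smult_submodule)
    fix a n assume "a \<in> I" and n: "n \<in> N"
    moreover have "n \<in> N <+>\<^bsub>M\<^esub> socle M I"
      using mem_set_addI[OF n submodule_zero[OF Ss]] Nc[OF n] by simp
    ultimately show "a \<odot>\<^bsub>M\<^esub> n \<in> ideal_smult R M I (N <+>\<^bsub>M\<^esub> socle M I)" by (simp add: ideal_smult_mem)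
  qed
qed

text \<open>The splitting is used as an isomorphism \<open>\<theta>\<close> from X to the direct sum
  of N and k that respects the projections to k. The copy of k in the sum is killed by m, so its
  preimage consists of socle elements.\<close>

lemma colon_subset_add_socle:
  assumes loc: "noetherian_local_ring R \<mm>" and fg: "fin_gen_module R M" and N: "submodule N R M"
    and Ext: "Ext1_mu R (residue_module R \<mm>) (M\<lparr>carrier := N\<rparr>)
      = {Ext1_zero R (residue_module R \<mm>) (M\<lparr>carrier := N\<rparr>)}"
  shows "mod_colon M (ideal_smult R M \<mm> N) \<mm> \<subseteq> N <+>\<^bsub>M\<^esub> socle M \<mm>"
proof
  interpret loc: noetherian_local_ring R \<mm> by fact
  let ?K = "residue_module R \<mm>" and ?N = "M\<lparr>carrier := N\<rparr>"
  note Nc = subsetD[OF submoduleE(1)[OF N]]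
  note Ss = socle_submodule[OF loc.a_subset]
  have Km: "module R ?K" by (intro residue_module_module R.is_cring loc.is_ideal)
  have Nm: "module R ?N" using submodule.submodule_is_module[OF N module_axioms] .
  interpret K: module R ?K by (rule Km)
  interpret N: module R ?N by (rule Nm)
  fix x assume colon: "x \<in> mod_colon M (ideal_smult R M \<mm> N) \<mm>"
  then have x: "x \<in> carrier M" and mx: "\<And>a. a \<in> \<mm> \<Longrightarrow> a \<odot>\<^bsub>M\<^esub> x \<in> ideal_smult R M \<mm> N"
    by (auto simp: mod_colon_def)
  have "ideal_smult R M \<mm> N \<subseteq> N"
    using loc.a_Hcarr submoduleE(4)[OF N] by (intro ideal_smult_minimal N) auto
  then have mxN: "a \<odot>\<^bsub>M\<^esub> x \<in> N" if "a \<in> \<mm>" for a using mx[OF that] by auto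
  show "x \<in> N <+>\<^bsub>M\<^esub> socle M \<mm>"
  proof (cases "x \<in> N")
    case True
    then show ?thesis using mem_set_addI[OF True submodule_zero[OF Ss]] x by simp
  next
    case False
    define X where "X = multiples (carrier R) x <+>\<^bsub>M\<^esub> N"
    define p where "p y = {r \<in> carrier R. y \<ominus>\<^bsub>M\<^esub> r \<odot>\<^bsub>M\<^esub> x \<in> N}" for y
    let ?X = "module.truncate (M\<lparr>carrier := X\<rparr>)"
    have Xs: "submodule X R M"
      unfolding X_def by (intro submodule_sum multiples_submodule R.oneideal x N)
    note Xc = subsetD[OF submoduleE(1)[OF Xs]]
    have Xm: "module R (M\<lparr>carrier := X\<rparr>)" using submodule.submodule_is_module[OF Xs module_axioms] .
    have "\<one> \<odot>\<^bsub>M\<^esub> x \<oplus>\<^bsub>M\<^esub> \<zero>\<^bsub>M\<^esub> \<in> X"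
      unfolding X_def using submodule_zero[OF N] by (intro mem_set_addI) (auto simp: multiples_def)
    then have xX: "x \<in> X" using x by simp
    have E: "(?X, \<lambda>n. n, p) \<in> short_exact_sequences R ?K ?N"
      using residue_extension[OF loc N x False mxN X_def] unfolding p_def[abs_def] .
    \<comment> \<open>\<open>Ext1\<close> is built from extensions on this product type, so X is
      first moved there.\<close>
    obtain X' :: "('a, 'c \<times> 'a set) module" and i' p'
      where E': "(X', i', p') \<in> short_exact_sequences R ?K ?N"
        and eq: "ext_equivalent R ?K ?N (?X, \<lambda>n. n, p) (X', i', p')"
      using extension_representative[OF Km Nm E] by blast
    obtain \<phi> where \<phi>: "\<phi> \<in> module_homs R ?X X'" "bij_betw \<phi> (carrier ?X) (carrier X')"
      "\<And>n. n \<in> carrier ?N \<Longrightarrow> \<phi> n = i' n" "\<And>y. y \<in> carrier ?X \<Longrightarrow> p' (\<phi> y) = p y"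
      using eq by (auto simp: ext_equivalent_def)
    have X'm: "module R X'" using E' by (simp add: short_exact_sequences_def)
    \<comment> \<open>Finite generation passes from M to N because R is Noetherian; the count of
      generators requires it.\<close>
    obtain S where S: "finite S" "S \<subseteq> carrier M" "mod_span R M S = carrier M"
      using fg by (auto simp: fin_gen_module_def)
    have "\<exists>T. finite T \<and> T \<subseteq> N \<and> mod_span R M T = N"
      using S(3) Nc
      by (intro submodule_fin_gen[OF loc.noetherian_ring_axioms module_axioms S(1,2) N]) auto
    then have "fin_gen_module R ?N"
      using mod_span_restrict[OF N] by (auto simp: fin_gen_module_def)
    \<comment> \<open>The colon condition enters here in full strength, with m x in mN; for
      exactness it was enough that m x lies in N.\<close>
    then have "min_gens R (M\<lparr>carrier := X\<rparr>) = Suc (min_gens R ?N)"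
      by (intro min_gens_extend[OF loc N _ x False mx X_def])
    then have mu: "min_gens R X' = min_gens R ?K + min_gens R ?N"
      using min_gens_iso[OF module_truncate[OF Xm] X'm \<phi>(1,2)] min_gens_truncate[OF Xm]
        loc.min_gens_residue_module by simp
    let ?\<xi> = "ext_rel R ?K ?N `` {(X', i', p')}"
    have self: "(X', i', p') \<in> ?\<xi>" using equiv_class_self[OF equiv_ext_rel E'] .
    have "?\<xi> \<in> Ext1_mu R ?K ?N"
      unfolding Ext1_mu_def Ext1_def using self mu E' by (auto intro: quotientI)
    then have "?\<xi> = Ext1_zero R ?K ?N" using Ext by simp
    then have "(split_extension ?K ?N, (X', i', p')) \<in> ext_rel R ?K ?N"
      using self by (auto simp: Ext1_zero_def)
    then have "((X', i', p'), split_extension ?K ?N) \<in> ext_rel R ?K ?N"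
      using equiv_ext_rel[of R ?K ?N] by (metis equivE symE)
    then obtain \<psi> where \<psi>: "\<psi> \<in> module_homs R X' (direct_sum ?N ?K)"
      "bij_betw \<psi> (carrier X') (carrier (direct_sum ?N ?K))"
      "\<And>z. z \<in> carrier X' \<Longrightarrow> snd (\<psi> z) = p' z"
      by (auto simp: ext_rel_def ext_equivalent_def split_extension_def)
    define \<theta> where "\<theta> = \<psi> \<circ> \<phi>"
    have carX: "carrier ?X = X" by (simp add: module.defs)
    have \<theta>_hom: "\<theta> \<in> module_homs R ?X (direct_sum ?N ?K)"
      using \<phi>(1) \<psi>(1) by (auto simp: \<theta>_def module_homs_def Pi_iff)
    have \<theta>_bij: "bij_betw \<theta> X (carrier (direct_sum ?N ?K))"
      unfolding \<theta>_def using \<phi>(2) \<psi>(2) carX by (metis bij_betw_trans)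
    have \<theta>_snd: "snd (\<theta> y) = p y" if "y \<in> X" for y
      using that \<psi>(3)[of "\<phi> y"] \<phi>(1,4) carX by (auto simp: \<theta>_def module_homs_def)
    have \<theta>_smult: "\<theta> (a \<odot>\<^bsub>M\<^esub> y) = (a \<odot>\<^bsub>M\<^esub> fst (\<theta> y), a \<odot>\<^bsub>?K\<^esub> p y)" if "a \<in> carrier R" "y \<in> X" for a y
    proof -
      have "\<theta> (a \<odot>\<^bsub>M\<^esub> y) = a \<odot>\<^bsub>direct_sum ?N ?K\<^esub> \<theta> y"
        using \<theta>_hom that by (simp add: module_homs_def module.defs)
      then show ?thesis
        using \<theta>_snd[OF that(2)] by (simp add: direct_sum_def case_prod_beta)
    qed
    have p_hom: "p \<in> module_homs R ?X ?K" using E by (simp add: short_exact_sequences_def)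
    have "p x \<in> carrier ?K" using p_hom xX carX by (auto simp: module_homs_def)
    then have "(\<zero>\<^bsub>M\<^esub>, p x) \<in> carrier (direct_sum ?N ?K)"
      using submodule_zero[OF N] by (simp add: direct_sum_def)
    \<comment> \<open>This y is the value at the class of x of the section of p given by the second
      summand.\<close>
    then obtain y where y: "y \<in> X" "\<theta> y = (\<zero>\<^bsub>M\<^esub>, p x)"
      using \<theta>_bij by (metis bij_betw_imp_surj_on imageE)
    have pyx: "p y = p x" using \<theta>_snd[OF y(1)] y(2) by simp
    \<comment> \<open>The second component of \<open>\<theta>\<close> at a y is a times the class of
      x, which vanishes since a x lies in N; injectivity of \<open>\<theta>\<close> does the
      rest.\<close>
    have "a \<odot>\<^bsub>M\<^esub> y = \<zero>\<^bsub>M\<^esub>" if a: "a \<in> \<mm>" for a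
    proof -
      have ac: "a \<in> carrier R" using a by (rule loc.a_Hcarr)
      have "a \<odot>\<^bsub>M\<^esub> x \<in> N" using mxN[OF a] .
      then have "p (a \<odot>\<^bsub>M\<^esub> x) = \<zero>\<^bsub>?K\<^esub>"
        using E by (auto simp: short_exact_sequences_def a_kernel_def kernel_def)
      moreover have "p (a \<odot>\<^bsub>M\<^esub> x) = a \<odot>\<^bsub>?K\<^esub> p x"
        using p_hom ac xX by (simp add: module_homs_def module.defs)
      ultimately have "\<theta> (a \<odot>\<^bsub>M\<^esub> y) = (\<zero>\<^bsub>M\<^esub>, \<zero>\<^bsub>?K\<^esub>)"
        using \<theta>_smult[OF ac y(1)] y(2) pyx ac by simp
      also have "\<dots> = \<theta> \<zero>\<^bsub>M\<^esub>"
        using module_homs_zero[OF module_truncate[OF Xm] direct_sum_module[OF Km Nm] \<theta>_hom]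
        by (simp add: direct_sum_def module.defs)
      finally show ?thesis
        using \<theta>_bij submoduleE(4)[OF Xs ac y(1)] submodule_zero[OF Xs]
        by (auto simp: bij_betw_def dest: inj_onD)
    qed
    then have "y \<in> socle M \<mm>" using Xc[OF y(1)] by (simp add: socle_def mod_colon_def)
    \<comment> \<open>The equality of \<open>p y\<close> and \<open>p x\<close> is evaluated at 1:
      that 1 is a coordinate of y means y - x lies in N.\<close>
    moreover have "\<one> \<in> p x" using x submodule_zero[OF N] by (simp add: p_def M.minus_eq M.r_neg)
    then have "\<one> \<in> p y" using pyx by simp
    then have "y \<ominus>\<^bsub>M\<^esub> x \<in> N" using x by (simp add: p_def)
    then have "\<ominus>\<^bsub>M\<^esub> (y \<ominus>\<^bsub>M\<^esub> x) \<in> N" by (rule submoduleE(3)[OF N])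
    moreover have "x = \<ominus>\<^bsub>M\<^esub> (y \<ominus>\<^bsub>M\<^esub> x) \<oplus>\<^bsub>M\<^esub> y"
      using x Xc[OF y(1)] by (simp add: M.minus_eq M.minus_add M.a_ac M.r_neg)
    ultimately show ?thesis using mem_set_addI by metis
  qed
qed

end

section \<open>From the colon formula to weak fullness\<close>

theorem proposition5p1p11:
  fixes R :: "('a, 'm) ring_scheme" and \<mm> :: "'a set"
    and M :: "('a, 'b, 'n) module_scheme" and N :: "'b set"
  assumes "noetherian_local_ring R \<mm>"
    and "module R M"
    and "fin_gen_module R M"
    and "submodule N R M"
    and "Ext1_mu R (residue_module R \<mm>) (M\<lparr>carrier := N\<rparr>)
           = {Ext1_zero R (residue_module R \<mm>) (M\<lparr>carrier := N\<rparr>)}"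
  shows "mod_colon M (ideal_smult R M \<mm> N) \<mm> = N <+>\<^bsub>M\<^esub> socle M \<mm>
    \<and> weakly_full R \<mm> M (N <+>\<^bsub>M\<^esub> socle M \<mm>)
    \<and> (0 < depth R \<mm> M \<longrightarrow> weakly_full R \<mm> M N)"
proof -
  interpret loc: noetherian_local_ring R \<mm> by fact
  interpret module R M by fact
  note N = assms(4)
  note Ss = socle_submodule[OF loc.a_subset]
  have "N <+>\<^bsub>M\<^esub> socle M \<mm> \<subseteq> mod_colon M (ideal_smult R M \<mm> N) \<mm>"
    using ideal_smult_mem[of _ \<mm> _ "N <+>\<^bsub>M\<^esub> socle M \<mm>"] ideal_smult_add_socle[OF loc.a_subset N]
      submoduleE(1)[OF submodule_sum[OF N Ss]]
    by (auto simp: mod_colon_def)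
  with colon_subset_add_socle[OF assms(1,3,4,5)]
  have eq: "mod_colon M (ideal_smult R M \<mm> N) \<mm> = N <+>\<^bsub>M\<^esub> socle M \<mm>" by blast
  then have full: "weakly_full R \<mm> M (N <+>\<^bsub>M\<^esub> socle M \<mm>)"
    using submodule_sum[OF N Ss] ideal_smult_add_socle[OF loc.a_subset N]
    by (simp add: weakly_full_def)
  have "N <+>\<^bsub>M\<^esub> {\<zero>\<^bsub>M\<^esub>} = N"
    using submoduleE(1)[OF N] by (auto simp: set_add_def' subset_iff)
  then have "weakly_full R \<mm> M N" if "0 < depth R \<mm> M"
    using full socle_eq_zero_of_depth_pos[OF loc.a_subset that] by simp
  with eq full show ?thesis by blast
qed

end
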